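(* Let $\rho_{A_1A_2\cdots A_n}$ be an $n$-qubit state, and let $k\geq 1$, $0<q\leq 1$, $0<s\leq 1$, $\beta\geq s$. Put $l=\frac{(1+k)^{\beta/s}-q^{\beta/s}}{k^{\beta/s}}$. Write $\mathcal N_{a,A_1A_i}=\mathcal N_a(\rho_{A_1A_i})$ and $\mathcal N_{a,A_1|A_{j+1}\cdots A_n}=\mathcal N_a(\rho_{A_1|A_{j+1}\cdots A_n})$ (so $\mathcal N_{a,A_1|A_n}=\mathcal N_{a,A_1A_n}$). (1) Let $n\geq 4$ and $2\leq m\leq n-2$. If $k\,\mathcal N^s_{a,A_1A_i}\leq \mathcal N^s_{a,A_1|A_{i+1}\cdots A_n}$ for $i=2,\dots,m$ and $\mathcal N^s_{a,A_1A_j}\geq k\,\mathcal N^s_{a,A_1|A_{j+1}\cdots A_n}$ for $j=m+1,\dots,n-1$, then $$\mathcal N^\beta_{a,A_1|A_2\cdots A_n}\leq q^{\beta/s}\big(\mathcal N^\beta_{a,A_1A_2}+l\mathcal N^\beta_{a,A_1A_3}+\cdots+l^{m-2}\mathcal N^\beta_{a,A_1A_m}\big)+l^m\big[\mathcal N^\beta_{a,A_1A_{m+1}}+q^{\beta/s}\mathcal N^\beta_{a,A_1A_{m+2}}+\cdots+q^{(n-m-2)\beta/s}\mathcal N^\beta_{a,A_1A_{n-1}}\big]+l^{m-1}q^{(n-m-1)\beta/s}\mathcal N^\beta_{a,A_1A_n}.$$ (2) Let $n\geq 3$. If $k\,\mathcal N^s_{a,A_1A_i}\leq \mathcal N^s_{a,A_1|A_{i+1}\cdots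 A_n}$ for $i=2,\dots,n-1$, then $$\mathcal N^\beta_{a,A_1|A_2\cdots A_n}\leq q^{\beta/s}\big(\mathcal N^\beta_{a,A_1A_2}+l\mathcal N^\beta_{a,A_1A_3}+\cdots+l^{n-3}\mathcal N^\beta_{a,A_1A_{n-1}}\big)+l^{n-2}\mathcal N^\beta_{a,A_1A_n}.$$ (3) Let $n\geq 3$. If $\mathcal N^s_{a,A_1A_j}\geq k\,\mathcal N^s_{a,A_1|A_{j+1}\cdots A_n}$ for $j=2,\dots,n-1$, then $$\mathcal N^\beta_{a,A_1|A_2\cdots A_n}\leq l\big[\mathcal N^\beta_{a,A_1A_2}+q^{\beta/s}\mathcal N^\beta_{a,A_1A_3}+\cdots+q^{(n-3)\beta/s}\mathcal N^\beta_{a,A_1A_{n-1}}\big]+q^{(n-2)\beta/s}\mathcal N^\beta_{a,A_1A_n}.$$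
   Context: For a bipartite pure state $|\varphi\rangle_{XY}$, its negativity is $\mathcal N(|\varphi\rangle)=\|(|\varphi\rangle\langle\varphi|)^{T_X}\|_{tr}-1=(\mathrm{tr}\sqrt{\rho_X})^2-1$, where $T_X$ is the partial transpose on $X$, $\|\cdot\|_{tr}$ the trace norm, $\rho_X=\mathrm{tr}_Y|\varphi\rangle\langle\varphi|$. The negativity of assistance of a bipartite state $\rho_{XY}$ is $\mathcal N_a(\rho_{XY})=\max\sum_ip_i\mathcal N(|\varphi_i\rangle)$ over all pure-state ensembles $\{p_i,|\varphi_i\rangle\}$ of $\rho_{XY}$. For the $n$-qubit state, $\rho_{A_1A_i}$ is the reduced state on $A_1A_i$ and $\rho_{A_1|A_{j+1}\cdots A_n}$ is the reduced state on $A_1A_{j+1}\cdots A_n$ regarded as bipartite for the cut $A_1$ versus $A_{j+1}\cdots A_n$. *)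

theory Defs
  imports Complex_Main "Jordan_Normal_Form.Matrix"
begin

definition psd :: "nat \<Rightarrow> complex mat \<Rightarrow> bool" where
  "psd d A \<longleftrightarrow> A \<in> carrier_mat d d \<and>
     (\<forall>v :: complex vec. dim_vec v = d \<longrightarrow>
        (let z = (\<Sum>i<d. \<Sum>j<d. cnj (v $ i) * A $$ (i, j) * v $ j)
         in Im z = 0 \<and> Re z \<ge> 0))"

definition mtrace :: "complex mat \<Rightarrow> complex" where
  "mtrace A = (\<Sum>i<dim_row A. A $$ (i, i))"

definition density :: "nat \<Rightarrow> complex mat \<Rightarrow> bool" where
  "density d \<rho> \<longleftrightarrow> psd d \<rho> \<and> mtrace \<rho> = 1"

definition psd_sqrt :: "complex mat \<Rightarrow> complex mat" where
  "psd_sqrt A = (THE B. psd (dim_row A) B \<and> B * B = A)"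

definition unit_vec_c :: "nat \<Rightarrow> complex vec \<Rightarrow> bool" where
  "unit_vec_c d \<phi> \<longleftrightarrow> dim_vec \<phi> = d \<and> (\<Sum>i<d. (cmod (\<phi> $ i))\<^sup>2) = 1"

definition proj :: "complex vec \<Rightarrow> complex mat" where
  "proj \<phi> = mat (dim_vec \<phi>) (dim_vec \<phi>) (\<lambda>(i, j). \<phi> $ i * cnj (\<phi> $ j))"

text \<open>Bipartite system X Y with dimensions dX, dY; the basis vector |x>|y> has
  index x * dY + y (Kronecker convention).  Reduced state on X of a pure state.\<close>
definition red_X :: "nat \<Rightarrow> nat \<Rightarrow> complex vec \<Rightarrow> complex mat" where
  "red_X dX dY \<phi> = mat dX dX (\<lambda>(a, b). \<Sum>y<dY. \<phi> $ (a * dY + y) * cnj (\<phi> $ (b * dY + y)))"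

definition negativity_pure :: "nat \<Rightarrow> nat \<Rightarrow> complex vec \<Rightarrow> real" where
  "negativity_pure dX dY \<phi> = (Re (mtrace (psd_sqrt (red_X dX dY \<phi>))))\<^sup>2 - 1"

definition pure_ensemble :: "nat \<Rightarrow> complex mat \<Rightarrow> (real \<times> complex vec) list \<Rightarrow> bool" where
  "pure_ensemble d \<rho> E \<longleftrightarrow>
     (\<forall>(p, \<phi>) \<in> set E. p \<ge> 0 \<and> unit_vec_c d \<phi>) \<and>
     (\<Sum>(p, \<phi>) \<leftarrow> E. p) = 1 \<and>
     \<rho> = mat d d (\<lambda>(i, j). \<Sum>(p, \<phi>) \<leftarrow> E. complex_of_real p * (\<phi> $ i * cnj (\<phi> $ j)))"

definition neg_assist :: "nat \<Rightarrow> nat \<Rightarrow> complex mat \<Rightarrow> real" where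
  "neg_assist dX dY \<rho> =
     (SUP E \<in> {E. pure_ensemble (dX * dY) \<rho> E}. \<Sum>(p, \<phi>) \<leftarrow> E. p * negativity_pure dX dY \<phi>)"

text \<open>n-qubit systems.  Qubits are numbered 0..n-1 (qubit t is A_(t+1) of the paper).
  In an m-qubit system qubit t is the bit of weight 2^(m-1-t) of the basis index
  (so qubit 0 is the most significant one, matching the Kronecker order).\<close>
definition qbit :: "nat \<Rightarrow> nat \<Rightarrow> nat \<Rightarrow> nat" where
  "qbit m x t = x div 2 ^ (m - 1 - t) mod 2"

text \<open>Basis index of the n-qubit system whose qubits qs (listed in increasing order)
  carry the bits of a (as an |qs|-qubit index) and whose qubits rs carry the bits of c.\<close>
definition merge_idx :: "nat \<Rightarrow> nat list \<Rightarrow> nat list \<Rightarrow> nat \<Rightarrow> nat \<Rightarrow> nat" where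
  "merge_idx n qs rs a c =
     (\<Sum>t<length qs. qbit (length qs) a t * 2 ^ (n - 1 - qs ! t)) +
     (\<Sum>t<length rs. qbit (length rs) c t * 2 ^ (n - 1 - rs ! t))"

text \<open>Reduced state of an n-qubit state rho on the set S of qubits (partial trace over
  the complement); the qubits of S keep their relative order.\<close>
definition reduced :: "nat \<Rightarrow> nat set \<Rightarrow> complex mat \<Rightarrow> complex mat" where
  "reduced n S \<rho> =
     (let qs = sorted_list_of_set S; rs = sorted_list_of_set ({0..<n} - S)
      in mat (2 ^ length qs) (2 ^ length qs)
           (\<lambda>(a, b). \<Sum>c<2 ^ length rs. \<rho> $$ (merge_idx n qs rs a c, merge_idx n qs rs b c)))"

text \<open>Negativity of assistance of the reduced state on S (which contains qubit 0 = A_1),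
  regarded as bipartite for the cut qubit 0 (= A_1) versus the remaining qubits of S.\<close>
definition NA :: "nat \<Rightarrow> complex mat \<Rightarrow> nat set \<Rightarrow> real" where
  "NA n \<rho> S = neg_assist 2 (2 ^ (card S - 1)) (reduced n S \<rho>)"

end

theory Submission
  imports Defs
begin

text \<open>
  For a pure state \<open>|0>u + |1>v\<close> of a qubit and a second system the negativity is the concurrence
  \<open>2 |u \<and> v|\<close>. The theorem rests on the polygamy relation
  \<open>N\<^sub>a(A|BC) \<le> N\<^sub>a(A|B) + N\<^sub>a(A|C)\<close> for a qubit \<open>A\<close>.
  Polarising \<open>f \<mapsto> 2 u \<and> v\<close> gives a symmetric bilinear form \<open>W\<close> with values in the exterior square, and for an
  unnormalised ensemble \<open>(f\<^sub>c)\<close> the quantity \<open>F\<^sup>2 = \<Sum>\<^sub>c\<^sub>,\<^sub>c\<^sub>' |W(f\<^sub>c, f\<^sub>c\<^sub>')|\<^sup>2\<close> depends only on the mixed state.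
  A Jacobi-type argument shows \<open>F \<le> N\<^sub>a\<close>: two successive rotations
  \<open>(f, g) \<mapsto> ((f + w g)/\<surd>2, (f - w g)/\<surd>2)\<close> with suitable phases \<open>w\<close> lead to
  \<open>|W(f,f)| = |W(g,g)| \<ge> |W(f,g)|\<close>. For a pure state of \<open>ABC\<close>, the splitting of the exterior square of \<open>B \<otimes> C\<close>
  gives \<open>N(A|BC)\<^sup>2 = F\<^sub>A\<^sub>B\<^sup>2 + F\<^sub>A\<^sub>C\<^sup>2\<close>, hence polygamy for pure and, by concatenating ensembles, for mixed states.
  The weighted inequalities then follow by iterating
  \<open>(X + Y)\<^sup>t \<le> q\<^sup>t X\<^sup>t + l Y\<^sup>t\<close> for \<open>k X \<le> Y\<close>, which holds since \<open>(1 + u)\<^sup>t - q\<^sup>t u\<^sup>t\<close> is increasing.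
\<close>

subsection \<open>The polarised concurrence\<close>

text \<open>A vector of \<open>\<complex>\<^sup>2 \<otimes> \<complex>\<^sup>d\<close> is a function \<open>f\<close> with components \<open>f b\<close> at \<open>|0>|b>\<close> and \<open>f (d + b)\<close> at
  \<open>|1>|b>\<close>. Writing \<open>f = |0>u + |1>v\<close>, the values \<open>wedge d f f\<close> are the coefficients of \<open>2 u \<and> v\<close>, and
  \<open>wedge d f g\<close> is the polarisation of this quadratic map.\<close>
definition wedge :: "nat \<Rightarrow> (nat \<Rightarrow> complex) \<Rightarrow> (nat \<Rightarrow> complex) \<Rightarrow> nat \<times> nat \<Rightarrow> complex" where
  "wedge d f g = (\<lambda>(b, c). f b * g (d + c) + g b * f (d + c) - f c * g (d + b) - g c * f (d + b))"

text \<open>The coefficients are antisymmetric and all ordered pairs are summed, so halving gives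
  the squared norm in the exterior square.\<close>

definition wedge_sq :: "nat \<Rightarrow> (nat \<Rightarrow> complex) \<Rightarrow> (nat \<Rightarrow> complex) \<Rightarrow> real" where
  "wedge_sq d f g = (\<Sum>x\<in>{..<d} \<times> {..<d}. (cmod (wedge d f g x))\<^sup>2) / 2"

definition conc :: "nat \<Rightarrow> (nat \<Rightarrow> complex) \<Rightarrow> real" where
  "conc d f = sqrt (wedge_sq d f f)"

lemma wedge_sq_nonneg [simp]: "wedge_sq d f g \<ge> 0"
  unfolding wedge_sq_def by (intro divide_nonneg_nonneg sum_nonneg) auto

lemma conc_nonneg [simp]: "conc d f \<ge> 0"
  by (simp add: conc_def)

lemma conc_sq: "(conc d f)\<^sup>2 = wedge_sq d f f"
  by (simp add: conc_def)

lemma cmod_sq_eq: "complex_of_real ((cmod z)\<^sup>2) = z * cnj z"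
  by (simp add: complex_mult_cnj cmod_power2)

lemma cmod_half_sq: "(cmod (z / 2))\<^sup>2 = ((Re z)\<^sup>2 + (Im z)\<^sup>2) / 4"
  by (simp add: norm_divide power_divide cmod_power2)

section \<open>Balancing rotations of a pair of vectors\<close>

lemma exists_phase_Re_zero: "\<exists>w. cmod w = 1 \<and> Re (w * \<kappa>) = 0"
proof (cases "\<kappa> = 0")
  case True then show ?thesis by (intro exI[of _ 1]) auto
next
  case False
  let ?w = "\<i> * cnj \<kappa> / complex_of_real (cmod \<kappa>)"
  have "?w * \<kappa> = \<i> * complex_of_real ((cmod \<kappa>)\<^sup>2 / cmod \<kappa>)"
    using cmod_sq_eq[of \<kappa>] by (simp add: field_simps)
  then have "Re (?w * \<kappa>) = 0" by simp
  then show ?thesis using False by (intro exI[of _ ?w]) (simp add: norm_mult norm_divide)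
qed

text \<open>For |w| = 1 the difference of the two sides is the real part of 2 w K with K independent
  of w, so a phase that makes w K imaginary balances them. Here \<open>A\<close>, \<open>B\<close>,
  \<open>C\<close> play the role of W(f,f), W(g,g), W(f,g).\<close>

lemma exists_balancing_phase:
  fixes A B C :: "'i \<Rightarrow> complex"
  shows "\<exists>w. cmod w = 1 \<and>
    (\<Sum>x\<in>I. (cmod ((A x + w\<^sup>2 * B x + 2 * w * C x) / 2))\<^sup>2) =
    (\<Sum>x\<in>I. (cmod ((A x + w\<^sup>2 * B x - 2 * w * C x) / 2))\<^sup>2)"
proof -
  obtain w where w: "cmod w = 1" "Re (w * (\<Sum>x\<in>I. cnj (A x) * C x + B x * cnj (C x))) = 0"
    using exists_phase_Re_zero by blast
  have ww: "w * cnj w = 1" using cmod_sq_eq[of w] w by simp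
  have par: "(cmod ((p + q) / 2))\<^sup>2 - (cmod ((p - q) / 2))\<^sup>2 = Re (cnj p * q)" for p q
    unfolding cmod_half_sq by (simp add: power2_eq_square field_simps)
  have "(cmod ((A x + w\<^sup>2 * B x + 2 * w * C x) / 2))\<^sup>2 - (cmod ((A x + w\<^sup>2 * B x - 2 * w * C x) / 2))\<^sup>2
      = 2 * Re (w * (cnj (A x) * C x + B x * cnj (C x)))" for x
  proof -
    \<comment> \<open>Conjugation does not change real parts; it replaces the factor
      \<open>cnj w\<close> by \<open>w\<close>, so that the whole difference becomes linear in
      \<open>w\<close>.\<close>
    have "cnj (w\<^sup>2 * B x) * (2 * w * C x) = 2 * cnj w * (w * cnj w) * (cnj (B x) * C x)"
      by (simp add: power2_eq_square)
    also have "\<dots> = cnj (2 * w * (B x * cnj (C x)))"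
      by (simp add: ww)
    finally have "Re (cnj (w\<^sup>2 * B x) * (2 * w * C x)) = Re (2 * w * (B x * cnj (C x)))"
      by (metis cnj.simps(1))
    then show ?thesis
      unfolding par by (simp add: algebra_simps)
  qed
  then have "(\<Sum>x\<in>I. (cmod ((A x + w\<^sup>2 * B x + 2 * w * C x) / 2))\<^sup>2) -
      (\<Sum>x\<in>I. (cmod ((A x + w\<^sup>2 * B x - 2 * w * C x) / 2))\<^sup>2)
      = (\<Sum>x\<in>I. 2 * Re (w * (cnj (A x) * C x + B x * cnj (C x))))"
    by (simp add: sum_subtractf[symmetric])
  also have "\<dots> = 2 * Re (w * (\<Sum>x\<in>I. cnj (A x) * C x + B x * cnj (C x)))"
    by (simp add: sum_distrib_left)
  finally show ?thesis using w by auto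
qed

text \<open>Exchanging two members of an ensemble in this way leaves the mixed state that it
  represents unchanged.\<close>

definition same_gram :: "(nat \<Rightarrow> complex) \<Rightarrow> (nat \<Rightarrow> complex) \<Rightarrow> (nat \<Rightarrow> complex) \<Rightarrow> (nat \<Rightarrow> complex) \<Rightarrow> bool" where
  "same_gram f g f' g' \<longleftrightarrow> (\<forall>i j. f' i * cnj (f' j) + g' i * cnj (g' j) = f i * cnj (f j) + g i * cnj (g j))"

text \<open>By bilinearity W(f',f') and W(g',g') are (A + w^2 B)/2 plus and minus w C, and W(f',g')
  = (A - w^2 B)/2. The phase equalises the norms of the first two, the parallelogram law gives the
  invariant, and the absence of C from the third gives the last bound.\<close>

lemma exists_balancing_rotation:
  obtains f' g' where "same_gram f g f' g'"
    and "wedge_sq d f' f' = wedge_sq d g' g'"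
    and "wedge_sq d f' f' + wedge_sq d g' g' + 2 * wedge_sq d f' g'
       = wedge_sq d f f + wedge_sq d g g + 2 * wedge_sq d f g"
    and "2 * wedge_sq d f' g' \<le> wedge_sq d f f + wedge_sq d g g"
proof -
  let ?I = "{..<d} \<times> {..<d}"
  let ?A = "wedge d f f" and ?B = "wedge d g g" and ?C = "wedge d f g"
  obtain w where w: "cmod w = 1" and bal: "(\<Sum>x\<in>?I. (cmod ((?A x + w\<^sup>2 * ?B x + 2 * w * ?C x) / 2))\<^sup>2) =
    (\<Sum>x\<in>?I. (cmod ((?A x + w\<^sup>2 * ?B x - 2 * w * ?C x) / 2))\<^sup>2)"
    using exists_balancing_phase by blast
  have ww: "w * cnj w = 1" using cmod_sq_eq[of w] w by simp
  define r where "r = complex_of_real (1 / sqrt 2)"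
  have rr: "r * r = 1 / 2"
    by (simp add: r_def flip: of_real_mult)
  have cr: "cnj r = r" by (simp add: r_def)
  define f' where "f' = (\<lambda>i. r * (f i + w * g i))"
  define g' where "g' = (\<lambda>i. r * (f i - w * g i))"
  have WA: "wedge d f' f' x = (?A x + w\<^sup>2 * ?B x + 2 * w * ?C x) / 2" for x
  proof (cases x)
    case (Pair b c)
    have "wedge d f' f' x = (r * r) * (?A x + w\<^sup>2 * ?B x + 2 * w * ?C x)"
      unfolding Pair wedge_def f'_def by (simp add: power2_eq_square algebra_simps)
    then show ?thesis by (simp add: rr)
  qed
  have WB: "wedge d g' g' x = (?A x + w\<^sup>2 * ?B x - 2 * w * ?C x) / 2" for x
  proof (cases x)
    case (Pair b c)
    have "wedge d g' g' x = (r * r) * (?A x + w\<^sup>2 * ?B x - 2 * w * ?C x)"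
      unfolding Pair wedge_def g'_def by (simp add: power2_eq_square algebra_simps)
    then show ?thesis by (simp add: rr)
  qed
  have WC: "wedge d f' g' x = (?A x - w\<^sup>2 * ?B x) / 2" for x
  proof (cases x)
    case (Pair b c)
    have "wedge d f' g' x = (r * r) * (?A x - w\<^sup>2 * ?B x)"
      unfolding Pair wedge_def f'_def g'_def by (simp add: power2_eq_square algebra_simps)
    then show ?thesis by (simp add: rr)
  qed
  have nB: "(cmod (w\<^sup>2 * ?B x))\<^sup>2 = (cmod (?B x))\<^sup>2" for x
    by (simp add: norm_mult norm_power w)
  have nC: "(cmod (2 * w * ?C x))\<^sup>2 = 4 * (cmod (?C x))\<^sup>2" for x
    by (simp add: norm_mult norm_power w power_mult_distrib)
  have par: "(cmod ((p + q + c) / 2))\<^sup>2 + (cmod ((p + q - c) / 2))\<^sup>2 + 2 * (cmod ((p - q) / 2))\<^sup>2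
     = (cmod p)\<^sup>2 + (cmod q)\<^sup>2 + (cmod c)\<^sup>2 / 2" for p q c
    unfolding cmod_half_sq cmod_power2 by (simp add: power2_eq_square field_simps)
  have inv: "(cmod (wedge d f' f' x))\<^sup>2 + (cmod (wedge d g' g' x))\<^sup>2 + 2 * (cmod (wedge d f' g' x))\<^sup>2
     = (cmod (?A x))\<^sup>2 + (cmod (?B x))\<^sup>2 + 2 * (cmod (?C x))\<^sup>2" for x
    unfolding WA WB WC par nB nC by simp
  have le: "2 * (cmod ((p - q) / 2))\<^sup>2 \<le> (cmod p)\<^sup>2 + (cmod q)\<^sup>2" for p q
  proof -
    have "(cmod p)\<^sup>2 + (cmod q)\<^sup>2 - 2 * (cmod ((p - q) / 2))\<^sup>2 = 2 * (cmod ((p + q) / 2))\<^sup>2"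
      unfolding cmod_half_sq cmod_power2 by (simp add: power2_eq_square field_simps)
    moreover have "0 \<le> 2 * (cmod ((p + q) / 2))\<^sup>2" by simp
    ultimately show ?thesis by linarith
  qed
  show ?thesis
  proof
    show "same_gram f g f' g'"
      unfolding same_gram_def
    proof (intro allI)
      fix i j
      have "f' i * cnj (f' j) + g' i * cnj (g' j)
        = 2 * (r * cnj r) * (f i * cnj (f j) + (w * cnj w) * (g i * cnj (g j)))"
        by (simp add: f'_def g'_def algebra_simps)
      then show "f' i * cnj (f' j) + g' i * cnj (g' j) = f i * cnj (f j) + g i * cnj (g j)"
        by (simp add: ww cr rr)
    qed
    show "wedge_sq d f' f' = wedge_sq d g' g'"
      unfolding wedge_sq_def WA WB using bal by simp
    have "(\<Sum>x\<in>?I. (cmod (wedge d f' f' x))\<^sup>2 + (cmod (wedge d g' g' x))\<^sup>2 + 2 * (cmod (wedge d f' g' x))\<^sup>2)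
     = (\<Sum>x\<in>?I. (cmod (?A x))\<^sup>2 + (cmod (?B x))\<^sup>2 + 2 * (cmod (?C x))\<^sup>2)"
      by (simp only: inv)
    then show "wedge_sq d f' f' + wedge_sq d g' g' + 2 * wedge_sq d f' g'
       = wedge_sq d f f + wedge_sq d g g + 2 * wedge_sq d f g"
      unfolding wedge_sq_def by (simp add: sum.distrib sum_distrib_left[symmetric] field_simps)
    have "(\<Sum>x\<in>?I. 2 * (cmod (wedge d f' g' x))\<^sup>2) \<le> (\<Sum>x\<in>?I. (cmod (?A x))\<^sup>2 + (cmod (?B x))\<^sup>2)"
      unfolding WC using le by (intro sum_mono) (metis nB)
    then show "2 * wedge_sq d f' g' \<le> wedge_sq d f f + wedge_sq d g g"
      unfolding wedge_sq_def by (simp add: sum.distrib sum_distrib_left[symmetric] field_simps)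
  qed
qed

text \<open>One balancing makes the two self norms equal. If the cross norm still exceeds them, a
  second balancing moves its weight to the diagonal.\<close>

lemma exists_dominating_rotation:
  obtains f' g' where "same_gram f g f' g'"
    and "wedge_sq d f' f' + wedge_sq d g' g' + 2 * wedge_sq d f' g'
       = wedge_sq d f f + wedge_sq d g g + 2 * wedge_sq d f g"
    and "wedge_sq d f' g' \<le> conc d f' * conc d g'"
proof -
  obtain f1 g1 where 1: "same_gram f g f1 g1" "wedge_sq d f1 f1 = wedge_sq d g1 g1"
    "wedge_sq d f1 f1 + wedge_sq d g1 g1 + 2 * wedge_sq d f1 g1
       = wedge_sq d f f + wedge_sq d g g + 2 * wedge_sq d f g"
    using exists_balancing_rotation by metis
  show ?thesis
  proof (cases "wedge_sq d f1 g1 \<le> wedge_sq d f1 f1")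
    case True
    show ?thesis by (rule that[OF 1(1,3)]) (use 1(2) True in \<open>simp add: conc_def flip: power2_eq_square\<close>)
  next
    case False
    obtain f2 g2 where 2: "same_gram f1 g1 f2 g2" "wedge_sq d f2 f2 = wedge_sq d g2 g2"
      "wedge_sq d f2 f2 + wedge_sq d g2 g2 + 2 * wedge_sq d f2 g2
       = wedge_sq d f1 f1 + wedge_sq d g1 g1 + 2 * wedge_sq d f1 g1"
      "2 * wedge_sq d f2 g2 \<le> wedge_sq d f1 f1 + wedge_sq d g1 g1"
      using exists_balancing_rotation by metis
    show ?thesis
    proof
      show "same_gram f g f2 g2" using 1(1) 2(1) by (simp add: same_gram_def)
      show "wedge_sq d f2 f2 + wedge_sq d g2 g2 + 2 * wedge_sq d f2 g2
       = wedge_sq d f f + wedge_sq d g g + 2 * wedge_sq d f g" using 1 2 by simp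
      \<comment> \<open>Write a, c for the squared self and cross norms before the second rotation
        and a', c' after it. Then c > a, a' + c' = a + c and c' \<le> a, so a' > a \<ge> c'.\<close>
      have "wedge_sq d f2 g2 \<le> wedge_sq d f2 f2" using 1(2) 2(2-4) False by linarith
      then show "wedge_sq d f2 g2 \<le> conc d f2 * conc d g2"
        using 2(2) by (simp add: conc_def flip: power2_eq_square)
    qed
  qed
qed

section \<open>Decompositions of a fixed mixed state\<close>

definition gram :: "nat \<Rightarrow> (nat \<Rightarrow> nat \<Rightarrow> complex) \<Rightarrow> nat \<Rightarrow> nat \<Rightarrow> complex" where
  "gram N f i j = (\<Sum>c<N. f c i * cnj (f c j))"

text \<open>This is F^2, the squared Frobenius norm of the form W on the family.\<close>

definition wedge_total :: "nat \<Rightarrow> nat \<Rightarrow> (nat \<Rightarrow> nat \<Rightarrow> complex) \<Rightarrow> real" where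
  "wedge_total d N f = (\<Sum>c<N. \<Sum>c'<N. wedge_sq d (f c) (f c'))"

text \<open>Each coefficient of W(f,g) is a signed sum of products of an entry of f and an entry of
  g. In its squared modulus the sums over \<open>c\<close> and \<open>c'\<close> therefore separate
  and give products of two entries of \<open>gram\<close>.\<close>

lemma wedge_total_cong_gram:
  assumes "gram N f = gram N g"
  shows "wedge_total d N f = wedge_total d N g"
proof -
  have key: "\<exists>Q. \<forall>h. complex_of_real (\<Sum>c<N. \<Sum>c'<N. (cmod (wedge d (h c) (h c') x))\<^sup>2) = Q (gram N h)" for x
  proof -
    obtain b e where x: "x = (b, e)" by (cases x)
    \<comment> \<open>The four products in \<open>wedge\<close> are listed by the index into the
      first vector, the index into the second vector and the sign.\<close>
    define p where "p = (!) [b, d + e, e, d + b]"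
    define q where "q = (!) [d + e, b, d + b, e]"
    define s where "s = (!) [1, 1, - 1, - 1 :: complex]"
    have W: "wedge d f g x = (\<Sum>t<4. s t * (f (p t) * g (q t)))" for f g
      by (simp add: x wedge_def p_def q_def s_def eval_nat_numeral)
    have cs: "cnj (s t) = s t" if "t < 4" for t
      using that by (auto simp: s_def eval_nat_numeral less_Suc_eq)
    have "complex_of_real (\<Sum>c<N. \<Sum>c'<N. (cmod (wedge d (h c) (h c') x))\<^sup>2)
      = (\<Sum>t<4. \<Sum>u<4. s t * s u * (gram N h (p t) (p u) * gram N h (q t) (q u)))" for h
    proof -
      have "complex_of_real (\<Sum>c<N. \<Sum>c'<N. (cmod (wedge d (h c) (h c') x))\<^sup>2)
        = (\<Sum>c<N. \<Sum>c'<N. \<Sum>t<4. \<Sum>u<4. s t * s u * ((h c (p t) * cnj (h c (p u))) * (h c' (q t) * cnj (h c' (q u)))))"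
        unfolding of_real_sum cmod_sq_eq W cnj_sum sum_product
        by (intro sum.cong refl) (simp add: cs mult_ac)
      also have "\<dots> = (\<Sum>c<N. \<Sum>t<4. \<Sum>c'<N. \<Sum>u<4. s t * s u * ((h c (p t) * cnj (h c (p u))) * (h c' (q t) * cnj (h c' (q u)))))"
        by (rule sum.cong[OF refl], rule sum.swap)
      also have "\<dots> = (\<Sum>t<4. \<Sum>c<N. \<Sum>u<4. \<Sum>c'<N. s t * s u * ((h c (p t) * cnj (h c (p u))) * (h c' (q t) * cnj (h c' (q u)))))"
        by (subst sum.swap) (rule sum.cong[OF refl], rule sum.cong[OF refl], rule sum.swap)
      also have "\<dots> = (\<Sum>t<4. \<Sum>u<4. \<Sum>c<N. \<Sum>c'<N. s t * s u * ((h c (p t) * cnj (h c (p u))) * (h c' (q t) * cnj (h c' (q u)))))"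
        by (rule sum.cong[OF refl], rule sum.swap)
      finally show ?thesis
        by (simp only: gram_def sum_product) (simp only: sum_distrib_left)
    qed
    then show ?thesis
      by (intro exI[of _ "\<lambda>R. \<Sum>t<4. \<Sum>u<4. s t * s u * (R (p t) (p u) * R (q t) (q u))"] allI)
  qed
  have "wedge_total d N h = (\<Sum>x\<in>{..<d} \<times> {..<d}. \<Sum>c<N. \<Sum>c'<N. (cmod (wedge d (h c) (h c') x))\<^sup>2) / 2" for h
    unfolding wedge_total_def wedge_sq_def sum_divide_distrib[symmetric]
    by (subst sum.swap, subst (2) sum.swap) simp
  moreover have "(\<Sum>c<N. \<Sum>c'<N. (cmod (wedge d (f c) (f c') x))\<^sup>2) = (\<Sum>c<N. \<Sum>c'<N. (cmod (wedge d (g c) (g c') x))\<^sup>2)" for x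
  proof -
    obtain Q where Q: "\<And>h. complex_of_real (\<Sum>c<N. \<Sum>c'<N. (cmod (wedge d (h c) (h c') x))\<^sup>2) = Q (gram N h)"
      using key[of x] by auto
    show ?thesis using Q[of f] Q[of g] unfolding assms by (simp only: of_real_eq_iff[symmetric, where 'a=complex])
  qed
  ultimately show ?thesis by (simp only:)
qed

lemma sum_fun_upd2:
  fixes F :: "'b \<Rightarrow> 'c::ab_group_add"
  assumes "i < N" "j < (N::nat)" "i \<noteq> j"
  shows "(\<Sum>c<N. F ((f(i := x, j := y)) c)) = (\<Sum>c<N. F (f c)) - F (f i) - F (f j) + F x + F y"
proof -
  have S: "{..<N} = insert i (insert j ({..<N} - {i, j}))" using assms by auto
  have "(\<Sum>c\<in>{..<N} - {i, j}. F ((f(i := x, j := y)) c)) = (\<Sum>c\<in>{..<N} - {i, j}. F (f c))"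
    by (intro sum.cong) auto
  then show ?thesis
    by (subst (1 2) S) (use assms in \<open>simp add: algebra_simps\<close>)
qed

text \<open>If the total concurrence is below the Frobenius norm of the form, some pair violates
  \<open>|W(f,g)|\<^sup>2 \<le> |W(f,f)| |W(g,g)|\<close>, and rotating that pair raises the total by a fixed amount.\<close>
lemma conc_family_increase:
  assumes "\<And>g. gram N g = gram N f \<Longrightarrow> (\<Sum>c<N. conc d (g c)) \<le> S"
    and "\<delta> > 0" and "(\<Sum>c<N. conc d (f c))\<^sup>2 + real (N * N) * \<delta> \<le> wedge_total d N f"
    and N: "N > 0"
  shows "\<exists>g. gram N g = gram N f \<and> S > 0 \<and> (\<Sum>c<N. conc d (g c)) \<ge> (\<Sum>c<N. conc d (f c)) + \<delta> / S"
proof -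
  \<comment> \<open>Otherwise summing the reverse strict inequality over all N^2 pairs contradicts
    the assumed gap.\<close>
  have "\<exists>i<N. \<exists>j<N. conc d (f i) * conc d (f j) + \<delta> \<le> wedge_sq d (f i) (f j)"
  proof (rule ccontr)
    assume "\<not> ?thesis"
    then have lt: "wedge_sq d (f i) (f j) < conc d (f i) * conc d (f j) + \<delta>" if "i < N" "j < N" for i j
      using that by (auto simp: not_le)
    have "wedge_total d N f < (\<Sum>i<N. \<Sum>j<N. conc d (f i) * conc d (f j) + \<delta>)"
      unfolding wedge_total_def using N
      by (intro sum_strict_mono) (auto intro!: lt)
    also have "\<dots> = (\<Sum>c<N. conc d (f c))\<^sup>2 + real (N * N) * \<delta>"
      by (simp add: sum.distrib power2_eq_square sum_product)
    finally show False using assms(3) by simp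
  qed
  then obtain i j where ij: "i < N" "j < N" "conc d (f i) * conc d (f j) + \<delta> \<le> wedge_sq d (f i) (f j)"
    by blast
  have ne: "i \<noteq> j" using ij(3) \<open>\<delta> > 0\<close> by (auto simp: conc_def simp flip: power2_eq_square)
  obtain x y where xy: "same_gram (f i) (f j) x y"
    "wedge_sq d x x + wedge_sq d y y + 2 * wedge_sq d x y
       = wedge_sq d (f i) (f i) + wedge_sq d (f j) (f j) + 2 * wedge_sq d (f i) (f j)"
    "wedge_sq d x y \<le> conc d x * conc d y"
    using exists_dominating_rotation by metis
  define g where "g = f(i := x, j := y)"
  have g: "gram N g = gram N f"
  proof (intro ext)
    fix a b
    have "x a * cnj (x b) + y a * cnj (y b) = f i a * cnj (f i b) + f j a * cnj (f j b)"
      using xy(1) unfolding same_gram_def by blast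
    moreover have "gram N g a b = gram N f a b
      + ((x a * cnj (x b) + y a * cnj (y b)) - (f i a * cnj (f i b) + f j a * cnj (f j b)))"
      unfolding gram_def g_def using sum_fun_upd2[OF ij(1,2) ne, of "\<lambda>h. h a * cnj (h b)" f x y]
      by (simp add: algebra_simps del: fun_upd_apply)
    ultimately show "gram N g a b = gram N f a b" by simp
  qed
  have sg: "(\<Sum>c<N. conc d (g c)) = (\<Sum>c<N. conc d (f c)) - conc d (f i) - conc d (f j) + conc d x + conc d y"
    unfolding g_def by (rule sum_fun_upd2[OF ij(1,2) ne, of "conc d"])
  \<comment> \<open>The rotation keeps the squared self norms plus twice the squared cross norm. The
    latter exceeded the product of concurrences by at least \<open>\<delta>\<close> before and does
    not exceed it afterwards, so the squared sum of the two concurrences grows by at least 2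
    \<open>\<delta>\<close>.\<close>
  define u where "u = conc d (f i) + conc d (f j)"
  define v where "v = conc d x + conc d y"
  have "v\<^sup>2 = wedge_sq d x x + wedge_sq d y y + 2 * (conc d x * conc d y)"
    unfolding v_def by (simp add: power2_sum conc_sq)
  moreover have "u\<^sup>2 = wedge_sq d (f i) (f i) + wedge_sq d (f j) (f j) + 2 * (conc d (f i) * conc d (f j))"
    unfolding u_def by (simp add: power2_sum conc_sq)
  ultimately have uv: "u\<^sup>2 + 2 * \<delta> \<le> v\<^sup>2" using xy(2,3) ij(3) by linarith
  have u0: "u \<ge> 0" and v0: "v \<ge> 0" unfolding u_def v_def by simp_all
  have uv': "u < v" using uv \<open>\<delta> > 0\<close> by (intro power2_less_imp_less[OF _ v0]) linarith
  have vS: "v \<le> S"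
  proof -
    have "(\<Sum>c\<in>{i, j}. conc d (g c)) \<le> (\<Sum>c<N. conc d (g c))"
      using ij by (intro sum_mono2) auto
    moreover have "(\<Sum>c\<in>{i, j}. conc d (g c)) = v" using ne by (simp add: g_def v_def)
    ultimately show ?thesis using assms(1)[OF g] by linarith
  qed
  \<comment> \<open>As \<open>u\<close> and \<open>v\<close> are at most \<open>S\<close>, the gain
    in squares becomes a gain of at least \<open>\<delta> / S\<close>.\<close>
  have "2 * \<delta> \<le> (v - u) * (v + u)" using uv by (simp add: power2_eq_square algebra_simps)
  also have "\<dots> \<le> (v - u) * (2 * S)" using uv' vS u0 by (intro mult_left_mono) auto
  finally have "\<delta> \<le> (v - u) * S" by simp
  moreover have S0: "S > 0" using u0 uv' vS by linarith
  ultimately have "\<delta> / S \<le> v - u" by (simp add: pos_divide_le_eq)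
  then have "(\<Sum>c<N. conc d (g c)) \<ge> (\<Sum>c<N. conc d (f c)) + \<delta> / S"
    using sg unfolding u_def v_def by linarith
  then show ?thesis using g S0 by blast
qed

text \<open>This is F \<le> N_a up to \<open>e\<close>; the slack stands in for attainment of the
  supremum. If all families stay \<open>e\<close> below F, each of them can be improved by a fixed
  amount, including one that is closer than this amount to the supremum.\<close>

lemma exists_family_conc_ge:
  assumes "e > 0"
  shows "\<exists>g. gram N g = gram N f \<and> sqrt (wedge_total d N f) - e < (\<Sum>c<N. conc d (g c))"
proof (rule ccontr)
  assume neg: "\<not> ?thesis"
  define X where "X = {\<Sum>c<N. conc d (g c) | g. gram N g = gram N f}"
  define S where "S = Sup X"
  have "N > 0" using neg assms by (cases "N = 0") (auto simp: wedge_total_def)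
  have ne: "X \<noteq> {}" unfolding X_def by auto
  have le: "x \<le> sqrt (wedge_total d N f) - e" if "x \<in> X" for x
    using that neg by (auto simp: X_def not_less)
  then have bdd: "bdd_above X" by (rule bdd_aboveI)
  have S1: "(\<Sum>c<N. conc d (g c)) \<le> S" if "gram N g = gram N f" for g
    unfolding S_def using that bdd by (intro cSup_upper) (auto simp: X_def)
  have S2: "S \<le> sqrt (wedge_total d N f) - e"
    unfolding S_def using ne le by (intro cSup_least) auto
  have S0: "S \<ge> 0" using S1[of f] by (meson conc_nonneg order_trans sum_nonneg)
  have W0: "wedge_total d N f \<ge> 0" unfolding wedge_total_def by (intro sum_nonneg) auto
  \<comment> \<open>The gap between F^2 and S^2, shared among the N^2 pairs as
    \<open>conc_family_increase\<close> demands.\<close>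
  define \<delta> where "\<delta> = (wedge_total d N f - S\<^sup>2) / real (N * N)"
  have "S\<^sup>2 < (sqrt (wedge_total d N f))\<^sup>2"
    using S0 S2 assms by (intro power_strict_mono) auto
  then have d: "\<delta> > 0" unfolding \<delta>_def using \<open>N > 0\<close> W0 by simp
  have step: "\<exists>h. gram N h = gram N f \<and> S > 0 \<and> (\<Sum>c<N. conc d (h c)) \<ge> (\<Sum>c<N. conc d (g c)) + \<delta> / S"
    if g: "gram N g = gram N f" for g
  proof -
    have "(\<Sum>c<N. conc d (g c))\<^sup>2 \<le> S\<^sup>2"
      using S1[OF g] by (intro power_mono sum_nonneg) auto
    then have "(\<Sum>c<N. conc d (g c))\<^sup>2 + real (N * N) * \<delta> \<le> wedge_total d N g"
      unfolding wedge_total_cong_gram[OF g] \<delta>_def using \<open>N > 0\<close> by simp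
    then show ?thesis
      using conc_family_increase[of N g d S \<delta>] S1 g d \<open>N > 0\<close> by auto
  qed
  then have "S > 0" by blast
  then have "S - \<delta> / S < Sup X" unfolding S_def[symmetric] using d by simp
  then obtain g where g: "gram N g = gram N f" "S - \<delta> / S < (\<Sum>c<N. conc d (g c))"
    using less_cSupD[OF ne] unfolding X_def by blast
  from step[OF g(1)] obtain h where h: "gram N h = gram N f"
    "(\<Sum>c<N. conc d (h c)) \<ge> (\<Sum>c<N. conc d (g c)) + \<delta> / S" by blast
  show False using S1[OF h(1)] h(2) g(2) by linarith
qed

subsection \<open>Concurrence of pure states\<close>

lemma sum_mult_split:
  fixes F :: "nat \<Rightarrow> 'a::comm_monoid_add"
  shows "(\<Sum>c<M * K. F c) = (\<Sum>a<M. \<Sum>b<K. F (a * K + b))"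
proof (induction M)
  case (Suc M)
  have "(\<Sum>c<Suc M * K. F c) = (\<Sum>c<M * K. F c) + (\<Sum>c=M * K..<M * K + K. F c)"
    by (simp add: sum.atLeastLessThan_concat add.commute flip: atLeast0LessThan)
  also have "(\<Sum>c=M * K..<M * K + K. F c) = (\<Sum>b<K. F (M * K + b))"
    using sum.shift_bounds_nat_ivl[of F 0 "M * K" K] by (simp add: atLeast0LessThan add.commute)
  finally show ?case using Suc by simp
qed simp

lemma sum_double_split:
  fixes F :: "nat \<Rightarrow> 'a::comm_monoid_add"
  shows "(\<Sum>i<2 * d. F i) = (\<Sum>i<d. F i) + (\<Sum>i<d. F (d + i))"
  using sum_mult_split[of F 2 d] by (simp add: eval_nat_numeral)

text \<open>Lagrange's identity.\<close>
lemma wedge_sq_self_eq: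
  "wedge_sq d f f = 4 * ((\<Sum>i<d. (cmod (f i))\<^sup>2) * (\<Sum>i<d. (cmod (f (d + i)))\<^sup>2)
     - (cmod (\<Sum>i<d. f i * cnj (f (d + i))))\<^sup>2)"
proof -
  let ?U = "\<Sum>i<d. (cmod (f i))\<^sup>2" and ?V = "\<Sum>i<d. (cmod (f (d + i)))\<^sup>2"
  let ?Z = "\<Sum>i<d. f i * cnj (f (d + i))"
  have pt: "complex_of_real ((cmod (wedge d f f (b, c)))\<^sup>2) =
     4 * ((f b * cnj (f b)) * (f (d + c) * cnj (f (d + c))) + (f (d + b) * cnj (f (d + b))) * (f c * cnj (f c))
     - (f b * cnj (f (d + b))) * cnj (f c * cnj (f (d + c))) - cnj (f b * cnj (f (d + b))) * (f c * cnj (f (d + c))))" for b c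
    unfolding cmod_sq_eq wedge_def by (simp add: algebra_simps)
  have Uc: "complex_of_real ?U = (\<Sum>i<d. f i * cnj (f i))" unfolding of_real_sum cmod_sq_eq ..
  have Vc: "complex_of_real ?V = (\<Sum>i<d. f (d + i) * cnj (f (d + i)))" unfolding of_real_sum cmod_sq_eq ..
  have "complex_of_real (\<Sum>x\<in>{..<d} \<times> {..<d}. (cmod (wedge d f f x))\<^sup>2) =
    (\<Sum>b<d. \<Sum>c<d. 4 * ((f b * cnj (f b)) * (f (d + c) * cnj (f (d + c))) + (f (d + b) * cnj (f (d + b))) * (f c * cnj (f c))
     - (f b * cnj (f (d + b))) * cnj (f c * cnj (f (d + c))) - cnj (f b * cnj (f (d + b))) * (f c * cnj (f (d + c)))))"
    by (simp only: sum.cartesian_product' of_real_sum pt)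
  also have "\<dots> = 4 * (complex_of_real ?U * complex_of_real ?V + complex_of_real ?V * complex_of_real ?U
      - ?Z * cnj ?Z - cnj ?Z * ?Z)"
    unfolding Uc Vc cnj_sum sum_product
    by (simp only: sum_distrib_left[symmetric] sum.distrib sum_subtractf)
  also have "\<dots> = complex_of_real (8 * (?U * ?V - (cmod ?Z)\<^sup>2))"
    using cmod_sq_eq[of ?Z] by (simp add: algebra_simps)
  finally show ?thesis unfolding wedge_sq_def of_real_eq_iff by simp
qed

text \<open>Discard the overlap in Lagrange's identity and apply the arithmetic-geometric mean
  inequality. This bounds the suprema over ensembles.\<close>

lemma conc_le_norm: "conc d f \<le> (\<Sum>i<2 * d. (cmod (f i))\<^sup>2)"
proof -
  let ?U = "\<Sum>i<d. (cmod (f i))\<^sup>2" and ?V = "\<Sum>i<d. (cmod (f (d + i)))\<^sup>2"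
  have "wedge_sq d f f \<le> 4 * (?U * ?V)" unfolding wedge_sq_self_eq by simp
  also have "\<dots> \<le> (?U + ?V)\<^sup>2"
    using zero_le_power2[of "?U - ?V"] by (simp add: power2_eq_square algebra_simps)
  finally show ?thesis
    unfolding conc_def sum_double_split
    by (intro real_le_lsqrt) (auto intro!: add_nonneg_nonneg sum_nonneg)
qed

text \<open>Homogeneity of degree two allows a probability p to be absorbed into a vector as the
  factor sqrt p.\<close>

lemma conc_scale: "conc d (\<lambda>i. complex_of_real r * f i) = r\<^sup>2 * conc d f"
proof -
  have "wedge d (\<lambda>i. complex_of_real r * f i) (\<lambda>i. complex_of_real r * f i) x = complex_of_real (r\<^sup>2) * wedge d f f x" for x
    by (cases x) (simp add: wedge_def power2_eq_square algebra_simps)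
  then have "wedge_sq d (\<lambda>i. complex_of_real r * f i) (\<lambda>i. complex_of_real r * f i) = (r\<^sup>2)\<^sup>2 * wedge_sq d f f"
    unfolding wedge_sq_def
    by (simp add: norm_mult power_mult_distrib sum_distrib_left norm_power)
  then show ?thesis unfolding conc_def by (simp only: real_sqrt_mult real_sqrt_abs) simp
qed

lemma conc_cong: "(\<And>i. i < 2 * d \<Longrightarrow> f i = g i) \<Longrightarrow> conc d f = conc d g"
  unfolding conc_def wedge_sq_def wedge_def
  by (intro arg_cong[where f=sqrt] arg_cong2[where f="(/)"] sum.cong refl) auto

subsection \<open>Positive semidefinite matrices\<close>

definition qform :: "nat \<Rightarrow> (nat \<Rightarrow> nat \<Rightarrow> complex) \<Rightarrow> (nat \<Rightarrow> complex) \<Rightarrow> complex" where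
  "qform d A v = (\<Sum>i<d. \<Sum>j<d. cnj (v i) * A i j * v j)"

text \<open>Quantifying over functions lets an induction on \<open>d\<close> extend a test vector by
  a single update.\<close>

definition nonneg_form :: "nat \<Rightarrow> (nat \<Rightarrow> nat \<Rightarrow> complex) \<Rightarrow> bool" where
  "nonneg_form d A \<longleftrightarrow> (\<forall>v. Im (qform d A v) = 0 \<and> Re (qform d A v) \<ge> 0)"

lemma qform_two:
  assumes "p < d" "q < d" "p \<noteq> q"
  shows "qform d A (\<lambda>i. if i = p then x else if i = q then y else 0)
    = cnj x * A p p * x + cnj x * A p q * y + cnj y * A q p * x + cnj y * A q q * y"
proof -
  let ?v = "\<lambda>i. if i = p then x else if i = q then y else 0"
  have red: "(\<Sum>i<d. F i) = F p + F q" if "\<And>i. i \<noteq> p \<Longrightarrow> i \<noteq> q \<Longrightarrow> F i = 0" for F :: "nat \<Rightarrow> complex"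
  proof -
    have "(\<Sum>i<d. F i) = (\<Sum>i\<in>{p, q}. F i)"
      by (rule sum.mono_neutral_right) (use assms that in auto)
    then show ?thesis using assms by simp
  qed
  have "qform d A ?v = (\<Sum>i<d. cnj (?v i) * A i p * ?v p + cnj (?v i) * A i q * ?v q)"
    unfolding qform_def by (rule sum.cong[OF refl], rule red) auto
  also have "\<dots> = cnj (?v p) * A p p * ?v p + cnj (?v p) * A p q * ?v q + (cnj (?v q) * A q p * ?v p + cnj (?v q) * A q q * ?v q)"
    by (rule red) auto
  finally show ?thesis using assms by simp
qed

lemma nonneg_form_diag:
  assumes "nonneg_form d A" "p < d"
  shows "Im (A p p) = 0" "Re (A p p) \<ge> 0"
proof -
  have "qform d A (\<lambda>i. if i = p then 1 else 0) = A p p"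
  proof -
    have "qform d A (\<lambda>i. if i = p then 1 else 0) = (\<Sum>i<d. \<Sum>j<d. if j = p then if i = p then A i j else 0 else 0)"
      unfolding qform_def by (rule sum.cong[OF refl], rule sum.cong[OF refl]) simp
    then show ?thesis using assms(2) by simp
  qed
  then show "Im (A p p) = 0" "Re (A p p) \<ge> 0"
    using assms(1) unfolding nonneg_form_def by metis+
qed

text \<open>Real values at the vectors (1, 1) and (1, i) on the coordinates \<open>p\<close>,
  \<open>q\<close> fix the imaginary and the real part respectively.\<close>

lemma nonneg_form_hermitian:
  assumes "nonneg_form d A" "p < d" "q < d"
  shows "A p q = cnj (A q p)"
proof (cases "p = q")
  case True
  then show ?thesis using nonneg_form_diag[OF assms(1,2)] by (simp add: complex_eq_iff)
next
  case False
  note two = qform_two[OF assms(2,3) False, of A]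
  have "Im (qform d A (\<lambda>i. if i = p then 1 else if i = q then 1 else 0)) = 0"
    "Im (qform d A (\<lambda>i. if i = p then 1 else if i = q then \<i> else 0)) = 0"
    using assms(1) unfolding nonneg_form_def by blast+
  then show ?thesis
    unfolding two using nonneg_form_diag[OF assms(1,2)] nonneg_form_diag[OF assms(1,3)]
    by (simp add: complex_eq_iff)
qed

lemma nonneg_form_zero_diag:
  assumes "nonneg_form d A" "p < d" "q < d" "A q q = 0"
  shows "A p q = 0"
proof (rule ccontr)
  assume nz: "A p q \<noteq> 0"
  then have ne: "p \<noteq> q" using assms(4) by auto
  have h: "A q p = cnj (A p q)" using nonneg_form_hermitian[OF assms(1,3,2)] .
  \<comment> \<open>With this \<open>t\<close> the form at the vector with entries 1 and
    \<open>- (t * cnj (A p q))\<close> has real part - Re (A p p) - 2, which is negative.\<close>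
  define t where "t = (Re (A p p) + 1) / (cmod (A p q))\<^sup>2"
  have "Re (qform d A (\<lambda>i. if i = p then 1 else if i = q then - (complex_of_real t * cnj (A p q)) else 0)) \<ge> 0"
    using assms(1) unfolding nonneg_form_def by blast
  also have "qform d A (\<lambda>i. if i = p then 1 else if i = q then - (complex_of_real t * cnj (A p q)) else 0)
     = A p p - 2 * complex_of_real t * (A p q * cnj (A p q))"
    unfolding qform_two[OF assms(2,3) ne] h assms(4) by (simp add: algebra_simps)
  also have "\<dots> = A p p - complex_of_real (2 * (Re (A p p) + 1))"
    unfolding cmod_sq_eq[symmetric] t_def using nz by simp
  finally show False using nonneg_form_diag[OF assms(1,2)] by simp
qed

text \<open>A Cholesky decomposition by induction on the dimension. If the last diagonal entry
  vanishes, so do its row and column; otherwise a rank-one matrix splits off and leaves the Schur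
  complement.\<close>

lemma nonneg_form_gram:
  assumes "nonneg_form d A"
  shows "\<exists>N f. \<forall>i<d. \<forall>j<d. A i j = gram N f i j"
  using assms
proof (induction d arbitrary: A)
  case (Suc n)
  note herm = nonneg_form_hermitian[OF Suc.prems]
  define \<alpha> where "\<alpha> = Re (A n n)"
  have \<alpha>: "A n n = complex_of_real \<alpha>" "\<alpha> \<ge> 0"
    using nonneg_form_diag[OF Suc.prems, of n] by (auto simp: complex_eq_iff \<alpha>_def)
  show ?case
  proof (cases "\<alpha> = 0")
    case True
    have z: "A i n = 0" "A n i = 0" if "i \<le> n" for i
      using nonneg_form_zero_diag[OF Suc.prems, of i n] herm[of n i] \<alpha> True that by auto
    have "qform n A v = qform (Suc n) A (v(n := 0))" for v
      unfolding qform_def by (simp add: z)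
    then have "nonneg_form n A" using Suc.prems unfolding nonneg_form_def by simp
    from Suc.IH[OF this] obtain N f where f: "\<forall>i<n. \<forall>j<n. A i j = gram N f i j" by blast
    show ?thesis
      by (rule exI[of _ N], rule exI[of _ "\<lambda>c. (f c)(n := 0)"]) (use f z in \<open>auto simp: gram_def less_Suc_eq\<close>)
  next
    case False
    then have pos: "\<alpha> > 0" using \<alpha> by simp
    define A' where "A' = (\<lambda>i j. A i j - A i n * A n j / complex_of_real \<alpha>)"
    \<comment> \<open>The inserted last coordinate minimises the form of \<open>A\<close>, so
      completing the square leaves the form of the Schur complement \<open>A'\<close>.\<close>
    have "qform n A' v = qform (Suc n) A (v(n := - (\<Sum>j<n. A n j * v j) / complex_of_real \<alpha>))" for v
    proof -
      define s where "s = (\<Sum>j<n. A n j * v j)"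
      have cs: "cnj s = (\<Sum>i<n. cnj (v i) * A i n)"
        unfolding s_def cnj_sum by (rule sum.cong) (auto simp: herm[of _ n] mult.commute)
      have "qform n A' v = qform n A v - cnj s * s / complex_of_real \<alpha>"
        unfolding qform_def A'_def cs unfolding s_def sum_product sum_divide_distrib sum_subtractf[symmetric]
        by (intro sum.cong refl) (simp add: algebra_simps)
      moreover have "qform (Suc n) A (v(n := w)) = qform n A v + cnj s * w + (cnj w * s + cnj w * A n n * w)" for w
        unfolding qform_def cs unfolding s_def
        by (simp add: sum.distrib sum_distrib_left sum_distrib_right mult_ac)
      ultimately show ?thesis
        unfolding s_def[symmetric] \<alpha>(1) using pos by (simp add: field_simps)
    qed
    then have "nonneg_form n A'" using Suc.prems unfolding nonneg_form_def by simp
    from Suc.IH[OF this] obtain N f where f: "\<forall>i<n. \<forall>j<n. A' i j = gram N f i j" by blast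
    define r where "r = complex_of_real (sqrt \<alpha>)"
    have rr: "r * r = complex_of_real \<alpha>" and cr: "cnj r = r" and r0: "r \<noteq> 0"
      using pos by (auto simp: r_def simp flip: of_real_mult)
    \<comment> \<open>Member 0 supplies the rank-one part removed from \<open>A\<close>. The others
      come from the induction hypothesis, which says nothing about coordinate \<open>n\<close>, so
      they are reset to 0 there.\<close>
    define g where "g = (\<lambda>c. case c of 0 \<Rightarrow> (\<lambda>i. A i n / r) | Suc c \<Rightarrow> (f c)(n := 0))"
    have gg: "gram (Suc N) g i j = A i n * cnj (A j n) / complex_of_real \<alpha> + (if i < n \<and> j < n then A' i j else 0)"
      if "i \<le> n" "j \<le> n" for i j
      unfolding gram_def sum.lessThan_Suc_shift using f that
      by (auto simp: g_def cr gram_def simp flip: rr)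
    have "A i j = gram (Suc N) g i j" if "i \<le> n" "j \<le> n" for i j
      using that herm[of n j] herm[of i n] \<alpha>(1) pos unfolding gg[OF that] A'_def by auto
    then show ?thesis by (metis less_Suc_eq_le)
  qed
qed auto

lemma psd_nonneg_form:
  assumes "psd d A" shows "nonneg_form d (\<lambda>i j. A $$ (i, j))"
  unfolding nonneg_form_def qform_def
proof (intro allI)
  fix v :: "nat \<Rightarrow> complex"
  show "Im (\<Sum>i<d. \<Sum>j<d. cnj (v i) * A $$ (i, j) * v j) = 0 \<and> 0 \<le> Re (\<Sum>i<d. \<Sum>j<d. cnj (v i) * A $$ (i, j) * v j)"
    using assms[unfolded psd_def Let_def, THEN conjunct2, rule_format, of "vec d v"] by simp
qed

section \<open>Square roots of positive 2x2 matrices\<close>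

definition herm2 :: "real \<Rightarrow> real \<Rightarrow> complex \<Rightarrow> complex mat" where
  "herm2 a b z = mat 2 2 (\<lambda>(i, j).
     if i = 0 then (if j = 0 then complex_of_real a else z) else (if j = 0 then cnj z else complex_of_real b))"

lemma herm2_simps [simp]:
  "herm2 a b z $$ (0, 0) = complex_of_real a" "herm2 a b z $$ (0, 1) = z"
  "herm2 a b z $$ (1, 0) = cnj z" "herm2 a b z $$ (1, 1) = complex_of_real b"
  "dim_row (herm2 a b z) = 2" "dim_col (herm2 a b z) = 2"
  by (simp_all add: herm2_def)

lemma sum_less_2: "(\<Sum>i<2. F i) = F 0 + F (1::nat)"
  by (simp add: numeral_2_eq_2)

text \<open>The mixed term is at most 2 sqrt a |x| sqrt b |y| in modulus, which the
  arithmetic-geometric mean inequality absorbs.\<close>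

lemma psd_herm2I:
  assumes "a \<ge> 0" "b \<ge> 0" "(cmod z)\<^sup>2 \<le> a * b"
  shows "psd 2 (herm2 a b z)"
  unfolding psd_def
proof (intro conjI allI impI)
  show "herm2 a b z \<in> carrier_mat 2 2" by (simp add: herm2_def)
  fix v :: "complex vec"
  define x y where "x = v $ 0" and "y = v $ 1"
  have q: "(\<Sum>i<2. \<Sum>j<2. cnj (v $ i) * herm2 a b z $$ (i, j) * v $ j)
    = complex_of_real (a * (cmod x)\<^sup>2 + b * (cmod y)\<^sup>2 + 2 * Re (cnj x * z * y))"
    unfolding sum_less_2 herm2_simps x_def[symmetric] y_def[symmetric] cmod_power2
    by (simp add: complex_eq_iff power2_eq_square algebra_simps)
  have "\<bar>Re (cnj x * z * y)\<bar> \<le> cmod x * cmod z * cmod y"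
    using abs_Re_le_cmod[of "cnj x * z * y"] by (simp add: norm_mult)
  also have "\<dots> \<le> cmod x * (sqrt a * sqrt b) * cmod y"
    using assms(3) by (intro mult_right_mono mult_left_mono) (auto simp: real_le_rsqrt simp flip: real_sqrt_mult)
  finally have "\<bar>Re (cnj x * z * y)\<bar> \<le> (sqrt a * cmod x) * (sqrt b * cmod y)" by (simp only: mult_ac)
  then have "2 * Re (cnj x * z * y) \<ge> - 2 * ((sqrt a * cmod x) * (sqrt b * cmod y))" by linarith
  moreover have "(sqrt a * cmod x)\<^sup>2 + (sqrt b * cmod y)\<^sup>2 \<ge> 2 * ((sqrt a * cmod x) * (sqrt b * cmod y))"
    using sum_squares_bound[of "sqrt a * cmod x" "sqrt b * cmod y"] by (simp add: mult_ac)
  ultimately have "a * (cmod x)\<^sup>2 + b * (cmod y)\<^sup>2 + 2 * Re (cnj x * z * y) \<ge> 0"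
    using assms by (simp add: power_mult_distrib)
  then show "let q = \<Sum>i<2. \<Sum>j<2. cnj (v $ i) * herm2 a b z $$ (i, j) * v $ j in Im q = 0 \<and> 0 \<le> Re q"
    unfolding q Let_def by simp
qed

text \<open>Stacking \<open>u\<close> and \<open>v\<close> into one vector turns the difference of
  the two sides into a quarter of a \<open>wedge_sq\<close>, by Lagrange's identity.\<close>

lemma cauchy_schwarz_lagrange:
  fixes d :: nat
  shows "(cmod (\<Sum>i<d. u i * cnj (v i)))\<^sup>2 \<le> (\<Sum>i<d. (cmod (u i))\<^sup>2) * (\<Sum>i<d. (cmod (v i))\<^sup>2)"
proof -
  have "0 \<le> wedge_sq d (\<lambda>i. if i < d then u i else v (i - d)) (\<lambda>i. if i < d then u i else v (i - d))" by simp
  then show ?thesis unfolding wedge_sq_self_eq by simp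
qed

text \<open>The determinant condition is the Cauchy-Schwarz inequality for a Gram decomposition of
  the matrix.\<close>

lemma psd_2E:
  assumes "psd 2 A"
  obtains a b z where "a \<ge> 0" "b \<ge> 0" "(cmod z)\<^sup>2 \<le> a * b" "A = herm2 a b z"
proof -
  obtain N f where f: "\<And>i j. i < 2 \<Longrightarrow> j < 2 \<Longrightarrow> A $$ (i, j) = gram N f i j"
    using nonneg_form_gram[OF psd_nonneg_form[OF assms]] by blast
  let ?a = "\<Sum>c<N. (cmod (f c 0))\<^sup>2" and ?b = "\<Sum>c<N. (cmod (f c 1))\<^sup>2"
  show ?thesis
  proof
    show "?a \<ge> 0" "?b \<ge> 0" by (auto intro: sum_nonneg)
    show "(cmod (gram N f 0 1))\<^sup>2 \<le> ?a * ?b" unfolding gram_def by (rule cauchy_schwarz_lagrange)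
    show "A = herm2 ?a ?b (gram N f 0 1)"
    proof (rule eq_matI)
      fix i j assume "i < dim_row (herm2 ?a ?b (gram N f 0 1))" "j < dim_col (herm2 ?a ?b (gram N f 0 1))"
      then have ij: "i < 2" "j < 2" by simp_all
      have d: "complex_of_real ?a = gram N f 0 0" "complex_of_real ?b = gram N f 1 1"
        unfolding gram_def of_real_sum cmod_sq_eq by simp_all
      have h: "cnj (gram N f 0 1) = gram N f 1 0" unfolding gram_def by (simp add: mult.commute)
      have "i = 0 \<or> i = 1" "j = 0 \<or> j = 1" using ij by auto
      then show "A $$ (i, j) = herm2 ?a ?b (gram N f 0 1) $$ (i, j)"
        unfolding f[OF ij] by (elim disjE) (simp_all only: herm2_simps d h)
    qed (use assms in \<open>auto simp: psd_def\<close>)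
  qed
qed

lemma herm2_square: "herm2 a b z * herm2 a b z = herm2 (a\<^sup>2 + (cmod z)\<^sup>2) (b\<^sup>2 + (cmod z)\<^sup>2) (complex_of_real (a + b) * z)"
proof (rule eq_matI)
  fix i j assume "i < dim_row (herm2 (a\<^sup>2 + (cmod z)\<^sup>2) (b\<^sup>2 + (cmod z)\<^sup>2) (complex_of_real (a + b) * z))"
    and "j < dim_col (herm2 (a\<^sup>2 + (cmod z)\<^sup>2) (b\<^sup>2 + (cmod z)\<^sup>2) (complex_of_real (a + b) * z))"
  then have ij: "i < 2" "j < 2" by simp_all
  then have "(herm2 a b z * herm2 a b z) $$ (i, j) = herm2 a b z $$ (i, 0) * herm2 a b z $$ (0, j)
      + herm2 a b z $$ (i, 1) * herm2 a b z $$ (1, j)"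
    by (simp add: scalar_prod_def atLeast0LessThan sum_less_2)
  moreover have "i = 0 \<or> i = 1" "j = 0 \<or> j = 1" using ij by auto
  ultimately show "(herm2 a b z * herm2 a b z) $$ (i, j)
      = herm2 (a\<^sup>2 + (cmod z)\<^sup>2) (b\<^sup>2 + (cmod z)\<^sup>2) (complex_of_real (a + b) * z) $$ (i, j)"
    unfolding cmod_power2
    by (elim disjE) (simp_all add: complex_eq_iff power2_eq_square algebra_simps del: One_nat_def)
qed simp_all

lemma herm2_eq_iff: "herm2 a b z = herm2 a' b' z' \<longleftrightarrow> a = a' \<and> b = b' \<and> z = z'"
proof
  assume eq: "herm2 a b z = herm2 a' b' z'"
  have "herm2 a b z $$ (0, 0) = herm2 a' b' z' $$ (0, 0)" "herm2 a b z $$ (0, 1) = herm2 a' b' z' $$ (0, 1)"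
    "herm2 a b z $$ (1, 1) = herm2 a' b' z' $$ (1, 1)" by (simp_all only: eq)
  then show "a = a' \<and> b = b' \<and> z = z'" by (simp del: One_nat_def)
qed simp

text \<open>By Cayley--Hamilton, the square root of a positive 2x2 matrix \<open>A\<close> with determinant \<open>s\<^sup>2\<close> and
  trace \<open>t\<^sup>2 - 2 s\<close> is \<open>(A + s) / t\<close>.\<close>
lemma psd_sqrt_herm2:
  assumes "a \<ge> 0" "b \<ge> 0" "(cmod z)\<^sup>2 \<le> a * b" "a + b > 0"
    and s: "s = sqrt (a * b - (cmod z)\<^sup>2)" and t: "t = sqrt (a + b + 2 * s)"
  shows "psd_sqrt (herm2 a b z) = herm2 ((a + s) / t) ((b + s) / t) (z / complex_of_real t)"
proof -
  have s0: "s \<ge> 0" and s2: "s\<^sup>2 = a * b - (cmod z)\<^sup>2" using assms(3) by (auto simp: s)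
  have "a + b + 2 * s > 0" using assms(4) s0 by linarith
  then have t0: "t > 0" unfolding t by simp
  have t2: "t\<^sup>2 = a + b + 2 * s" using assms(4) s0 by (simp add: t)
  have nz: "(cmod (z / complex_of_real t))\<^sup>2 = (cmod z)\<^sup>2 / t\<^sup>2" by (simp add: norm_divide power_divide)
  have p: "psd 2 (herm2 ((a + s) / t) ((b + s) / t) (z / complex_of_real t))"
  proof (rule psd_herm2I)
    have "(cmod z)\<^sup>2 \<le> (a + s) * (b + s)"
      using assms(3) mult_nonneg_nonneg[OF assms(1) s0] mult_nonneg_nonneg[OF s0 assms(2)] mult_nonneg_nonneg[OF s0 s0]
      unfolding distrib_left distrib_right by linarith
    then show "(cmod (z / complex_of_real t))\<^sup>2 \<le> (a + s) / t * ((b + s) / t)"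
      unfolding nz using t0 by (simp add: power2_eq_square divide_right_mono)
  qed (use assms s0 t0 in auto)
  have h: "((x + s) / t)\<^sup>2 + (cmod z)\<^sup>2 / t\<^sup>2 = x" if "x = a \<or> x = b" for x
  proof -
    have "(x + s)\<^sup>2 + (cmod z)\<^sup>2 = x * t\<^sup>2"
      unfolding t2 using that s2 by (auto simp: power2_eq_square algebra_simps)
    then show ?thesis using t0 by (simp add: power_divide add_divide_distrib[symmetric])
  qed
  have "(a + s) / t + (b + s) / t = t"
  proof -
    have "(a + s) / t + (b + s) / t = t\<^sup>2 / t" unfolding t2 by (simp add: add_divide_distrib[symmetric])
    then show ?thesis by (simp add: power2_eq_square)
  qed
  then have sq: "herm2 ((a + s) / t) ((b + s) / t) (z / complex_of_real t) * herm2 ((a + s) / t) ((b + s) / t) (z / complex_of_real t) = herm2 a b z"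
    unfolding herm2_square nz using h t0 by simp
  show ?thesis
    unfolding psd_sqrt_def
  proof (rule the_equality)
    show "psd (dim_row (herm2 a b z)) (herm2 ((a + s) / t) ((b + s) / t) (z / complex_of_real t)) \<and>
      herm2 ((a + s) / t) ((b + s) / t) (z / complex_of_real t) * herm2 ((a + s) / t) ((b + s) / t) (z / complex_of_real t) = herm2 a b z"
      using p sq by (simp add: herm2_def)
    \<comment> \<open>Uniqueness: a positive root \<open>B\<close> has determinant \<open>s\<close>
      and trace \<open>t\<close>, so Cayley-Hamilton determines \<open>B\<close>.\<close>
    fix B assume B: "psd (dim_row (herm2 a b z)) B \<and> B * B = herm2 a b z"
    then have "psd 2 B" by (simp add: herm2_def)
    then obtain a' b' z' where B': "a' \<ge> 0" "b' \<ge> 0" "(cmod z')\<^sup>2 \<le> a' * b'" "B = herm2 a' b' z'"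
      by (rule psd_2E)
    then have e: "a = a'\<^sup>2 + (cmod z')\<^sup>2" "b = b'\<^sup>2 + (cmod z')\<^sup>2" "z = complex_of_real (a' + b') * z'"
      using B unfolding B'(4) herm2_square herm2_eq_iff by auto
    have "(cmod z)\<^sup>2 = (a' + b')\<^sup>2 * (cmod z')\<^sup>2"
      unfolding e(3) norm_mult power_mult_distrib norm_of_real by simp
    then have "a * b - (cmod z)\<^sup>2 = (a' * b' - (cmod z')\<^sup>2)\<^sup>2"
      unfolding e(1,2) by (simp add: power2_eq_square algebra_simps)
    then have s': "s = a' * b' - (cmod z')\<^sup>2" using B'(3) by (simp add: s)
    have "a + b + 2 * s = (a' + b')\<^sup>2" unfolding e s' by (simp add: power2_eq_square algebra_simps)
    then have t': "t = a' + b'" using B' by (simp add: t)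
    have "a + s = a' * t" "b + s = b' * t" unfolding e s' t' by (simp_all add: power2_eq_square algebra_simps)
    then show "B = herm2 ((a + s) / t) ((b + s) / t) (z / complex_of_real t)"
      unfolding B'(4) herm2_eq_iff e(3) t'[symmetric] using t0 by simp
  qed
qed

text \<open>The root of the reduced state has trace t with t^2 = 1 + 2 s, so the negativity is 2 s,
  twice the square root of the determinant. Lagrange's identity identifies this with the
  concurrence.\<close>

lemma negativity_pure_eq_conc:
  assumes "unit_vec_c (2 * d) \<phi>"
  shows "negativity_pure 2 d \<phi> = conc d (\<lambda>i. \<phi> $ i)"
proof -
  define a b z where "a = (\<Sum>i<d. (cmod (\<phi> $ i))\<^sup>2)" and "b = (\<Sum>i<d. (cmod (\<phi> $ (d + i)))\<^sup>2)"
    and "z = (\<Sum>i<d. \<phi> $ i * cnj (\<phi> $ (d + i)))"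
  have ab: "a + b = 1" using assms unfolding unit_vec_c_def sum_double_split by (simp add: a_def b_def)
  have nn: "a \<ge> 0" "b \<ge> 0" "(cmod z)\<^sup>2 \<le> a * b"
    unfolding a_def b_def z_def by (auto intro: sum_nonneg cauchy_schwarz_lagrange)
  define s t where "s = sqrt (a * b - (cmod z)\<^sup>2)" and "t = sqrt (a + b + 2 * s)"
  have s0: "s \<ge> 0" using nn by (simp add: s_def)
  have t0: "t > 0" and t2: "t\<^sup>2 = a + b + 2 * s" using ab s0 by (auto simp: t_def)
  have red: "red_X 2 d \<phi> = herm2 a b z"
    unfolding red_X_def herm2_def a_def b_def z_def of_real_sum cmod_sq_eq
    by (intro eq_matI) (auto simp: less_2_cases_iff mult.commute)
  have "mtrace (psd_sqrt (red_X 2 d \<phi>)) = complex_of_real ((a + s) / t + (b + s) / t)"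
    unfolding red psd_sqrt_herm2[OF nn _ s_def t_def, unfolded ab, simplified]
    by (simp add: mtrace_def sum_less_2 del: One_nat_def)
  also have "(a + s) / t + (b + s) / t = t"
  proof -
    have "(a + s) / t + (b + s) / t = t\<^sup>2 / t" unfolding t2 by (simp add: add_divide_distrib[symmetric])
    then show ?thesis by (simp add: power2_eq_square)
  qed
  finally have "negativity_pure 2 d \<phi> = 2 * s" unfolding negativity_pure_def using t2 ab by simp
  also have "\<dots> = conc d (\<lambda>i. \<phi> $ i)"
    unfolding conc_def wedge_sq_self_eq s_def a_def b_def z_def real_sqrt_mult by simp
  finally show ?thesis .
qed

subsection \<open>Negativity of assistance through Gram decompositions\<close>

text \<open>Ensembles become lists of unnormalised vectors sqrt p times phi: the squared norms are
  the weights, and \<open>conc_sum\<close> is the average negativity.\<close>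

definition osum :: "(nat \<Rightarrow> complex) list \<Rightarrow> nat \<Rightarrow> nat \<Rightarrow> complex" where
  "osum L i j = (\<Sum>f\<leftarrow>L. f i * cnj (f j))"

definition gram_mat :: "nat \<Rightarrow> (nat \<Rightarrow> complex) list \<Rightarrow> complex mat" where
  "gram_mat D L = mat D D (\<lambda>(i, j). osum L i j)"

definition conc_sum :: "nat \<Rightarrow> (nat \<Rightarrow> complex) list \<Rightarrow> real" where
  "conc_sum d L = (\<Sum>f\<leftarrow>L. conc d f)"

lemma sum_sum_list_swap:
  fixes F :: "'b \<Rightarrow> 'a \<Rightarrow> 'c::comm_monoid_add"
  shows "(\<Sum>i\<in>I. \<Sum>x\<leftarrow>L. F x i) = (\<Sum>x\<leftarrow>L. \<Sum>i\<in>I. F x i)"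
  by (induction L) (simp_all add: sum.distrib)

lemma of_real_sum_list: "of_real (\<Sum>x\<leftarrow>L. F x) = (\<Sum>x\<leftarrow>L. of_real (F x))"
  by (induction L) simp_all

lemma mtrace_gram_mat:
  "mtrace (gram_mat D L) = complex_of_real (\<Sum>f\<leftarrow>L. \<Sum>i<D. (cmod (f i))\<^sup>2)"
  unfolding of_real_sum_list of_real_sum cmod_sq_eq sum_sum_list_swap[symmetric]
  by (simp add: mtrace_def gram_mat_def osum_def)

lemma conc_sum_le_trace:
  assumes "mtrace (gram_mat (2 * d) L) = 1"
  shows "conc_sum d L \<le> 1"
proof -
  have "conc_sum d L \<le> (\<Sum>f\<leftarrow>L. \<Sum>i<2 * d. (cmod (f i))\<^sup>2)"
    unfolding conc_sum_def by (rule sum_list_mono) (rule conc_le_norm)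
  also have "\<dots> = 1" using assms unfolding mtrace_gram_mat of_real_eq_1_iff .
  finally show ?thesis .
qed

lemma pure_ensemble_to_gram_mat:
  assumes "pure_ensemble (2 * d) \<rho> E"
  shows "\<exists>L. gram_mat (2 * d) L = \<rho> \<and> conc_sum d L = (\<Sum>(p, \<phi>) \<leftarrow> E. p * negativity_pure 2 d \<phi>)"
proof -
  define L where "L = map (\<lambda>(p, \<phi>) i. complex_of_real (sqrt p) * \<phi> $ i) E"
  have E: "p \<ge> 0" "unit_vec_c (2 * d) \<phi>" if "(p, \<phi>) \<in> set E" for p \<phi>
    using assms that unfolding pure_ensemble_def by auto
  have o: "osum L i j = (\<Sum>(p, \<phi>) \<leftarrow> E. complex_of_real p * (\<phi> $ i * cnj (\<phi> $ j)))" for i j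
    unfolding osum_def L_def map_map
  proof (intro arg_cong[where f=sum_list] map_cong refl)
    fix x assume "x \<in> set E"
    obtain p \<phi> where x: "x = (p, \<phi>)" by (cases x)
    have "complex_of_real (sqrt p) * complex_of_real (sqrt p) = complex_of_real p"
      using E[of p \<phi>] \<open>x \<in> set E\<close> x by (simp flip: of_real_mult)
    then show "((\<lambda>f. f i * cnj (f j)) \<circ> (\<lambda>(p, \<phi>) i. complex_of_real (sqrt p) * \<phi> $ i)) x
      = (case x of (p, \<phi>) \<Rightarrow> complex_of_real p * (\<phi> $ i * cnj (\<phi> $ j)))"
      by (simp add: x mult_ac)
  qed
  have "gram_mat (2 * d) L = \<rho>"
    using assms unfolding pure_ensemble_def gram_mat_def o by blast
  moreover have "conc_sum d L = (\<Sum>(p, \<phi>) \<leftarrow> E. p * negativity_pure 2 d \<phi>)"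
    unfolding conc_sum_def L_def map_map
  proof (intro arg_cong[where f=sum_list] map_cong refl)
    fix x assume "x \<in> set E"
    moreover obtain p \<phi> where x: "x = (p, \<phi>)" by (cases x)
    ultimately show "(conc d \<circ> (\<lambda>(p, \<phi>) i. complex_of_real (sqrt p) * \<phi> $ i)) x
      = (case x of (p, \<phi>) \<Rightarrow> p * negativity_pure 2 d \<phi>)"
      using E by (simp add: conc_scale negativity_pure_eq_conc)
  qed
  ultimately show ?thesis by blast
qed

text \<open>Each vector is normalised and weighted by its squared norm. Zero vectors cannot be
  normalised and are filtered out; they contribute neither to the matrix nor to
  \<open>conc_sum\<close>.\<close>

lemma gram_mat_to_pure_ensemble:
  assumes tr: "mtrace (gram_mat (2 * d) L) = 1"
  shows "\<exists>E. pure_ensemble (2 * d) (gram_mat (2 * d) L) E \<and>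
    (\<Sum>(p, \<phi>) \<leftarrow> E. p * negativity_pure 2 d \<phi>) = conc_sum d L"
proof -
  define w where "w = (\<lambda>f :: nat \<Rightarrow> complex. \<Sum>i<2 * d. (cmod (f i))\<^sup>2)"
  define \<phi> where "\<phi> = (\<lambda>f. vec (2 * d) (\<lambda>i. complex_of_real (1 / sqrt (w f)) * f i))"
  define E where "E = map (\<lambda>f. (w f, \<phi> f)) (filter (\<lambda>f. w f \<noteq> 0) L)"
  have w0: "w f \<ge> 0" for f unfolding w_def by (intro sum_nonneg) simp
  have wz: "f i = 0" if "w f = 0" "i < 2 * d" for f i
    using that unfolding w_def by (subst (asm) sum_nonneg_eq_0_iff) auto
  have unit: "unit_vec_c (2 * d) (\<phi> f)" if "w f \<noteq> 0" for f
  proof -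
    have "(\<Sum>i<2 * d. (cmod (\<phi> f $ i))\<^sup>2) = (\<Sum>i<2 * d. (cmod (f i))\<^sup>2 / w f)"
      using w0[of f] by (intro sum.cong) (auto simp: \<phi>_def norm_mult norm_divide power_mult_distrib power_divide)
    also have "\<dots> = 1" using that by (simp add: sum_divide_distrib[symmetric] w_def)
    finally show ?thesis by (simp add: unit_vec_c_def \<phi>_def)
  qed
  have filt: "(\<Sum>(p, \<phi>) \<leftarrow> E. G p \<phi>) = (\<Sum>f\<leftarrow>L. G (w f) (\<phi> f))"
    if "\<And>f. w f = 0 \<Longrightarrow> G (w f) (\<phi> f) = 0" for G :: "real \<Rightarrow> complex vec \<Rightarrow> 'b::comm_monoid_add"
    unfolding E_def map_map o_def prod.case using that by (intro sum_list_map_filter) auto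
  have "(\<Sum>(p, \<phi>) \<leftarrow> E. p) = (\<Sum>f\<leftarrow>L. w f)"
    by (rule filt) simp
  also have "\<dots> = 1" using tr unfolding mtrace_gram_mat of_real_eq_1_iff w_def .
  finally have 1: "(\<Sum>(p, \<phi>) \<leftarrow> E. p) = 1" .
  have 2: "(\<Sum>(p, \<phi>) \<leftarrow> E. complex_of_real p * (\<phi> $ i * cnj (\<phi> $ j))) = osum L i j" if ij: "i < 2 * d" "j < 2 * d" for i j
  proof -
    have "complex_of_real (w f) * (\<phi> f $ i * cnj (\<phi> f $ j)) = f i * cnj (f j)" for f
    proof (cases "w f = 0")
      case True then show ?thesis using wz ij by simp
    next
      case False
      have "complex_of_real (w f) * (complex_of_real (1 / sqrt (w f)) * complex_of_real (1 / sqrt (w f))) = 1"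
        using False w0[of f] by (simp flip: of_real_mult)
      then show ?thesis using ij unfolding \<phi>_def
        by (simp add: mult_ac del: of_real_divide)
    qed
    then show ?thesis unfolding osum_def by (subst filt) auto
  qed
  have "gram_mat (2 * d) L = mat (2 * d) (2 * d) (\<lambda>(i, j). \<Sum>(p, \<phi>) \<leftarrow> E. complex_of_real p * (\<phi> $ i * cnj (\<phi> $ j)))"
    unfolding gram_mat_def by (intro eq_matI) (simp_all add: 2)
  moreover have "\<forall>(p, \<phi>) \<in> set E. p \<ge> 0 \<and> unit_vec_c (2 * d) \<phi>"
    using w0 unit by (auto simp: E_def)
  ultimately have "pure_ensemble (2 * d) (gram_mat (2 * d) L) E"
    unfolding pure_ensemble_def using 1 by blast
  moreover have "(\<Sum>(p, \<phi>) \<leftarrow> E. p * negativity_pure 2 d \<phi>) = conc_sum d L"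
  proof -
    have "w f * negativity_pure 2 d (\<phi> f) = conc d f" for f
    proof (cases "w f = 0")
      case True
      then have "conc d f \<le> 0" using conc_le_norm[of d f] by (simp add: w_def)
      then show ?thesis using True conc_nonneg[of d f] by simp
    next
      case False
      have "conc d (($) (\<phi> f)) = conc d (\<lambda>i. complex_of_real (1 / sqrt (w f)) * f i)"
        by (rule conc_cong) (simp add: \<phi>_def)
      then show ?thesis unfolding negativity_pure_eq_conc[OF unit[OF False]]
        using False w0[of f] by (simp add: conc_scale power_divide del: of_real_divide)
    qed
    then show ?thesis unfolding conc_sum_def by (subst filt) auto
  qed
  ultimately show ?thesis by blast
qed

lemma conc_sum_le_neg_assist:
  assumes "mtrace (gram_mat (2 * d) L) = 1"
  shows "conc_sum d L \<le> neg_assist 2 d (gram_mat (2 * d) L)"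
proof -
  obtain E where E: "pure_ensemble (2 * d) (gram_mat (2 * d) L) E"
    "(\<Sum>(p, \<phi>) \<leftarrow> E. p * negativity_pure 2 d \<phi>) = conc_sum d L"
    using gram_mat_to_pure_ensemble[OF assms] by blast
  \<comment> \<open>A real supremum is known to dominate the members only of a set that is bounded
    above; unit trace bounds every average by 1.\<close>
  have "bdd_above ((\<lambda>E. \<Sum>(p, \<phi>) \<leftarrow> E. p * negativity_pure 2 d \<phi>) ` {E. pure_ensemble (2 * d) (gram_mat (2 * d) L) E})"
  proof (rule bdd_aboveI2)
    fix E' assume "E' \<in> {E. pure_ensemble (2 * d) (gram_mat (2 * d) L) E}"
    then obtain L' where L': "gram_mat (2 * d) L' = gram_mat (2 * d) L"
      "conc_sum d L' = (\<Sum>(p, \<phi>) \<leftarrow> E'. p * negativity_pure 2 d \<phi>)"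
      using pure_ensemble_to_gram_mat by blast
    then show "(\<Sum>(p, \<phi>) \<leftarrow> E'. p * negativity_pure 2 d \<phi>) \<le> 1"
      using conc_sum_le_trace[of d L'] assms by simp
  qed
  then show ?thesis
    unfolding neg_assist_def E(2)[symmetric] using E(1) by (intro cSUP_upper) auto
qed

lemma neg_assist_least:
  assumes "mtrace (gram_mat (2 * d) L) = 1"
    and "\<And>L'. gram_mat (2 * d) L' = gram_mat (2 * d) L \<Longrightarrow> conc_sum d L' \<le> K"
  shows "neg_assist 2 d (gram_mat (2 * d) L) \<le> K"
  unfolding neg_assist_def
proof (rule cSUP_least)
  show "{E. pure_ensemble (2 * d) (gram_mat (2 * d) L) E} \<noteq> {}"
    using gram_mat_to_pure_ensemble[OF assms(1)] by blast
  fix E assume "E \<in> {E. pure_ensemble (2 * d) (gram_mat (2 * d) L) E}"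
  then show "(\<Sum>(p, \<phi>) \<leftarrow> E. p * negativity_pure 2 d \<phi>) \<le> K"
    using pure_ensemble_to_gram_mat[of d "gram_mat (2 * d) L" E] assms(2) by force
qed

lemma conc_sum_nonneg: "conc_sum d L \<ge> 0"
  unfolding conc_sum_def by (intro sum_list_nonneg) auto

lemma neg_assist_nonneg:
  assumes "mtrace (gram_mat (2 * d) L) = 1"
  shows "neg_assist 2 d (gram_mat (2 * d) L) \<ge> 0"
  using conc_sum_le_neg_assist[OF assms] conc_sum_nonneg[of d L] by linarith

text \<open>For a vector on A \<otimes> B \<otimes> C with the C index running fastest, the slices
  at all \<open>y\<close> form an ensemble of the reduced state on AB, as those of
  \<open>sliceC\<close> do for AC.\<close>

definition sliceB :: "nat \<Rightarrow> (nat \<Rightarrow> complex) \<Rightarrow> nat \<Rightarrow> nat \<Rightarrow> complex" where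
  "sliceB dC f y i = f (i * dC + y)"

text \<open>Quotient and remainder of \<open>i\<close> by \<open>dC\<close> are the A and C indices;
  the B index goes between them.\<close>

definition sliceC :: "nat \<Rightarrow> nat \<Rightarrow> (nat \<Rightarrow> complex) \<Rightarrow> nat \<Rightarrow> nat \<Rightarrow> complex" where
  "sliceC dB dC f b i = f (i div dC * (dB * dC) + b * dC + i mod dC)"

text \<open>The exterior square of \<open>B \<otimes> C\<close> splits into \<open>\<Lambda>\<^sup>2 B \<otimes> Sym\<^sup>2 C\<close> and \<open>Sym\<^sup>2 B \<otimes> \<Lambda>\<^sup>2 C\<close>.\<close>
lemma wedge_sq_split:
  "wedge_sq (dB * dC) f f = wedge_total dB dC (sliceB dC f) + wedge_total dC dB (sliceC dB dC f)"
proof -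
  define u where "u = (\<lambda>b y. f (b * dC + y))"
  define v where "v = (\<lambda>b y. f (dB * dC + (b * dC + y)))"
  \<comment> \<open>Up to a factor 2, \<open>M\<close> lists the coefficients of the wedge. The AB
    slices see it symmetrised in the C indices, the AC slices antisymmetrised, and the parallelogram
    law adds the two.\<close>
  define M where "M = (\<lambda>b b' y y'. u b y * v b' y' - u b' y' * v b y)"
  let ?S = "\<lambda>F. \<Sum>b<dB. \<Sum>b'<dB. \<Sum>y<dC. \<Sum>y'<dC. (F b b' y y' :: real)"
  have "wedge_sq (dB * dC) f f = (\<Sum>p<dB * dC. \<Sum>p'<dB * dC. (cmod (wedge (dB * dC) f f (p, p')))\<^sup>2) / 2"
    unfolding wedge_sq_def by (simp add: sum.cartesian_product)
  also have "\<dots> = (\<Sum>b<dB. \<Sum>y<dC. \<Sum>b'<dB. \<Sum>y'<dC. (cmod (wedge (dB * dC) f f (b * dC + y, b' * dC + y')))\<^sup>2) / 2"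
    unfolding sum_mult_split ..
  also have "\<dots> = (\<Sum>b<dB. \<Sum>y<dC. \<Sum>b'<dB. \<Sum>y'<dC. 4 * (cmod (M b b' y y'))\<^sup>2) / 2"
  proof -
    have "wedge (dB * dC) f f (b * dC + y, b' * dC + y') = 2 * M b b' y y'" for b b' y y'
      by (simp add: wedge_def M_def u_def v_def)
    then show ?thesis by (simp only: norm_mult power_mult_distrib) simp
  qed
  also have "\<dots> = ?S (\<lambda>b b' y y'. 4 * (cmod (M b b' y y'))\<^sup>2) / 2"
    by (intro arg_cong2[where f="(/)"] refl sum.cong[OF refl]) (rule sum.swap)
  finally have L: "wedge_sq (dB * dC) f f = ?S (\<lambda>b b' y y'. 4 * (cmod (M b b' y y'))\<^sup>2) / 2" .
  have "wedge_total dB dC (sliceB dC f) = (\<Sum>y<dC. \<Sum>y'<dC. \<Sum>b<dB. \<Sum>b'<dB. (cmod (M b b' y y' + M b b' y' y))\<^sup>2) / 2"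
  proof -
    have "wedge dB (sliceB dC f y) (sliceB dC f y') (b, b') = M b b' y y' + M b b' y' y" for b b' y y'
      by (simp add: wedge_def M_def u_def v_def sliceB_def algebra_simps)
    then show ?thesis
      unfolding wedge_total_def wedge_sq_def by (simp add: sum.cartesian_product' sum_divide_distrib)
  qed
  also have "\<dots> = (\<Sum>y<dC. \<Sum>b<dB. \<Sum>b'<dB. \<Sum>y'<dC. (cmod (M b b' y y' + M b b' y' y))\<^sup>2) / 2"
    by (subst sum.swap, subst (2) sum.swap) (rule refl)
  also have "\<dots> = ?S (\<lambda>b b' y y'. (cmod (M b b' y y' + M b b' y' y))\<^sup>2) / 2"
    by (subst sum.swap, subst (2) sum.swap) (rule refl)
  finally have B: "wedge_total dB dC (sliceB dC f) = ?S (\<lambda>b b' y y'. (cmod (M b b' y y' + M b b' y' y))\<^sup>2) / 2" .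
  have C: "wedge_total dC dB (sliceC dB dC f) = ?S (\<lambda>b b' y y'. (cmod (M b b' y y' - M b b' y' y))\<^sup>2) / 2"
  proof -
    have "wedge dC (sliceC dB dC f b) (sliceC dB dC f b') (y, y') = M b b' y y' - M b b' y' y"
      if "y < dC" "y' < dC" for b b' y y'
      using that by (simp add: wedge_def M_def u_def v_def sliceC_def algebra_simps)
    then show ?thesis
      unfolding wedge_total_def wedge_sq_def sum.cartesian_product' sum_divide_distrib[symmetric]
      by (intro arg_cong2[where f="(/)"] refl sum.cong[OF refl]) simp
  qed
  have par: "(cmod (p + q))\<^sup>2 + (cmod (p - q))\<^sup>2 = 2 * (cmod p)\<^sup>2 + 2 * (cmod q)\<^sup>2" for p q
    unfolding cmod_power2 by (simp add: power2_eq_square algebra_simps)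
  have "?S (\<lambda>b b' y y'. (cmod (M b b' y y' + M b b' y' y))\<^sup>2) + ?S (\<lambda>b b' y y'. (cmod (M b b' y y' - M b b' y' y))\<^sup>2)
     = ?S (\<lambda>b b' y y'. 2 * (cmod (M b b' y y'))\<^sup>2 + 2 * (cmod (M b b' y' y))\<^sup>2)"
    unfolding sum.distrib[symmetric] par ..
  also have "\<dots> = ?S (\<lambda>b b' y y'. 2 * (cmod (M b b' y y'))\<^sup>2) + ?S (\<lambda>b b' y y'. 2 * (cmod (M b b' y' y))\<^sup>2)"
    unfolding sum.distrib ..
  also have "?S (\<lambda>b b' y y'. 2 * (cmod (M b b' y' y))\<^sup>2) = ?S (\<lambda>b b' y y'. 2 * (cmod (M b b' y y'))\<^sup>2)"
    by (rule sum.cong[OF refl], rule sum.cong[OF refl], rule sum.swap)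
  also have "?S (\<lambda>b b' y y'. 2 * (cmod (M b b' y y'))\<^sup>2) + ?S (\<lambda>b b' y y'. 2 * (cmod (M b b' y y'))\<^sup>2)
      = ?S (\<lambda>b b' y y'. 4 * (cmod (M b b' y y'))\<^sup>2)"
    unfolding sum.distrib[symmetric] by simp
  finally show ?thesis unfolding L B C by (simp add: add_divide_distrib)
qed

subsection \<open>Polygamy\<close>

text \<open>Replacing each vector of a decomposition by an ensemble of its reduced state gives a
  decomposition of the reduced mixed state.\<close>

definition slices :: "nat \<Rightarrow> ((nat \<Rightarrow> complex) \<Rightarrow> nat \<Rightarrow> nat \<Rightarrow> complex) \<Rightarrow> (nat \<Rightarrow> complex) list \<Rightarrow> (nat \<Rightarrow> complex) list" where
  "slices N h L = concat (map (\<lambda>f. map (h f) [0..<N]) L)"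

lemma sum_list_slices: "(\<Sum>g\<leftarrow>slices N h L. F g) = (\<Sum>f\<leftarrow>L. \<Sum>c<N. F (h f c))"
  by (induction L) (simp_all add: slices_def o_def interv_sum_list_conv_sum_set_nat atLeast0LessThan)

lemma osum_slices: "osum (slices N h L) i j = (\<Sum>f\<leftarrow>L. gram N (h f) i j)"
  unfolding osum_def gram_def by (rule sum_list_slices)

lemma conc_sum_slices: "conc_sum d (slices N h L) = (\<Sum>f\<leftarrow>L. \<Sum>c<N. conc d (h f c))"
  unfolding conc_sum_def by (rule sum_list_slices)

section \<open>Partial traces of decomposed states\<close>

definition trace_C :: "nat \<Rightarrow> nat \<Rightarrow> complex mat \<Rightarrow> complex mat" where
  "trace_C dB dC \<sigma> = mat (2 * dB) (2 * dB) (\<lambda>(i, j). \<Sum>y<dC. \<sigma> $$ (i * dC + y, j * dC + y))"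

definition trace_B :: "nat \<Rightarrow> nat \<Rightarrow> complex mat \<Rightarrow> complex mat" where
  "trace_B dB dC \<sigma> = mat (2 * dC) (2 * dC) (\<lambda>(i, j). \<Sum>b<dB.
     \<sigma> $$ (i div dC * (dB * dC) + b * dC + i mod dC, j div dC * (dB * dC) + b * dC + j mod dC))"

lemma mult_add_less: "x < M \<Longrightarrow> y < K \<Longrightarrow> x * K + y < M * (K::nat)"
proof -
  assume "x < M" "y < K"
  then have "x * K + y < Suc x * K" "Suc x * K \<le> M * K" by (simp_all only: mult_le_mono1 Suc_leI) simp
  then show ?thesis by linarith
qed

lemma index_B_less:
  assumes "i < 2 * dC" "b < dB"
  shows "i div dC * (dB * dC) + b * dC + i mod dC < 2 * (dB * (dC::nat))"
proof -
  have "i div dC < 2" using assms(1) by (simp add: less_mult_imp_div_less)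
  then have "i div dC * dB + b < 2 * dB" using assms(2) by (rule mult_add_less)
  moreover have "i mod dC < dC" using assms(1) by (cases "dC = 0") auto
  ultimately have "(i div dC * dB + b) * dC + i mod dC < 2 * dB * dC" by (rule mult_add_less)
  then show ?thesis by (simp add: algebra_simps)
qed

lemma gram_mat_index: "i < D \<Longrightarrow> j < D \<Longrightarrow> gram_mat D L $$ (i, j) = osum L i j"
  by (simp add: gram_mat_def)

lemma trace_C_gram_mat:
  "trace_C dB dC (gram_mat (2 * (dB * dC)) L) = gram_mat (2 * dB) (slices dC (sliceB dC) L)"
  unfolding trace_C_def gram_mat_def[of "2 * dB"]
proof (intro cong_mat refl)
  fix i j assume "i < 2 * dB" "j < 2 * dB"
  then have "i * dC + y < 2 * (dB * dC)" "j * dC + y < 2 * (dB * dC)" if "y < dC" for y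
    using mult_add_less[of _ "2 * dB" y dC] that by (simp_all add: mult.assoc)
  then show "(case (i, j) of (i, j) \<Rightarrow> \<Sum>y<dC. gram_mat (2 * (dB * dC)) L $$ (i * dC + y, j * dC + y))
    = (case (i, j) of (i, j) \<Rightarrow> osum (slices dC (sliceB dC) L) i j)"
    by (simp add: gram_mat_index osum_slices gram_def sliceB_def sum_sum_list_swap[symmetric]) (simp add: osum_def)
qed

lemma trace_B_gram_mat:
  "trace_B dB dC (gram_mat (2 * (dB * dC)) L) = gram_mat (2 * dC) (slices dB (sliceC dB dC) L)"
  unfolding trace_B_def gram_mat_def[of "2 * dC"]
proof (intro cong_mat refl)
  fix i j assume "i < 2 * dC" "j < 2 * dC"
  then show "(case (i, j) of (i, j) \<Rightarrow> \<Sum>b<dB. gram_mat (2 * (dB * dC)) L $$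
      (i div dC * (dB * dC) + b * dC + i mod dC, j div dC * (dB * dC) + b * dC + j mod dC))
    = (case (i, j) of (i, j) \<Rightarrow> osum (slices dB (sliceC dB dC) L) i j)"
    by (simp add: gram_mat_index index_B_less osum_slices gram_def sliceC_def sum_sum_list_swap[symmetric])
      (simp add: osum_def)
qed

lemma mtrace_trace_C:
  assumes "dim_row \<sigma> = 2 * (dB * dC)"
  shows "mtrace (trace_C dB dC \<sigma>) = mtrace \<sigma>"
  using sum_mult_split[of "\<lambda>i. \<sigma> $$ (i, i)" "2 * dB" dC] assms
  by (simp add: mtrace_def trace_C_def mult.assoc)

lemma mtrace_trace_B:
  assumes "dim_row \<sigma> = 2 * (dB * dC)"
  shows "mtrace (trace_B dB dC \<sigma>) = mtrace \<sigma>"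
proof -
  have "mtrace \<sigma> = (\<Sum>x<2. \<Sum>b<dB. \<Sum>y<dC. \<sigma> $$ (x * (dB * dC) + (b * dC + y), x * (dB * dC) + (b * dC + y)))"
    unfolding mtrace_def assms sum_mult_split ..
  also have "\<dots> = (\<Sum>x<2. \<Sum>y<dC. \<Sum>b<dB. \<sigma> $$ (x * (dB * dC) + (b * dC + y), x * (dB * dC) + (b * dC + y)))"
    by (rule sum.cong[OF refl], rule sum.swap)
  also have "\<dots> = mtrace (trace_B dB dC \<sigma>)"
    unfolding mtrace_def trace_B_def dim_row_mat sum_mult_split
  proof (intro sum.cong refl)
    fix x y :: nat assume "x \<in> {..<2}" "y \<in> {..<dC}"
    then have "x * dC + y < 2 * dC" "(x * dC + y) div dC = x" "(x * dC + y) mod dC = y"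
      by (auto intro: mult_add_less)
    then show "(\<Sum>b<dB. \<sigma> $$ (x * (dB * dC) + (b * dC + y), x * (dB * dC) + (b * dC + y)))
      = mat (2 * dC) (2 * dC) (\<lambda>(i, j). \<Sum>b<dB. \<sigma> $$ (i div dC * (dB * dC) + b * dC + i mod dC,
          j div dC * (dB * dC) + b * dC + j mod dC)) $$ (x * dC + y, x * dC + y)"
      by (simp add: add.assoc)
  qed
  finally show ?thesis ..
qed

text \<open>In this form the property passes to partial traces simply by slicing the
  vectors.\<close>

definition gram_state :: "nat \<Rightarrow> complex mat \<Rightarrow> bool" where
  "gram_state D \<sigma> \<longleftrightarrow> (\<exists>L. \<sigma> = gram_mat D L) \<and> mtrace \<sigma> = 1"

lemma dim_gram_mat [simp]: "dim_row (gram_mat D L) = D" "dim_col (gram_mat D L) = D"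
  by (simp_all add: gram_mat_def)

lemma gram_state_trace_C: "gram_state (2 * (dB * dC)) \<sigma> \<Longrightarrow> gram_state (2 * dB) (trace_C dB dC \<sigma>)"
  unfolding gram_state_def using mtrace_trace_C[of \<sigma> dB dC] trace_C_gram_mat[of dB dC] by auto

lemma gram_state_trace_B: "gram_state (2 * (dB * dC)) \<sigma> \<Longrightarrow> gram_state (2 * dC) (trace_B dB dC \<sigma>)"
  unfolding gram_state_def using mtrace_trace_B[of \<sigma> dB dC] trace_B_gram_mat[of dB dC] by auto

lemma gram_state_neg_assist_nonneg: "gram_state (2 * d) \<sigma> \<Longrightarrow> neg_assist 2 d \<sigma> \<ge> 0"
  unfolding gram_state_def using neg_assist_nonneg by blast

text \<open>Each family of slices is replaced by a nearly optimal one with the same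
  \<open>gram\<close>, so the concatenated list still decomposes the same state. Every vector of
  \<open>L\<close> costs one slack \<open>e\<close>.\<close>

lemma slices_approx:
  assumes "e > 0" "mtrace (gram_mat (2 * d) (slices N h L)) = 1"
  shows "(\<Sum>f\<leftarrow>L. sqrt (wedge_total d N (h f))) \<le> neg_assist 2 d (gram_mat (2 * d) (slices N h L)) + real (length L) * e"
proof -
  have "\<forall>f. \<exists>g. gram N g = gram N (h f) \<and> sqrt (wedge_total d N (h f)) - e < (\<Sum>c<N. conc d (g c))"
    using exists_family_conc_ge[OF assms(1)] by blast
  then obtain g where g: "\<And>f. gram N (g f) = gram N (h f)"
    "\<And>f. sqrt (wedge_total d N (h f)) - e < (\<Sum>c<N. conc d (g f c))" by metis
  have eq: "gram_mat (2 * d) (slices N g L) = gram_mat (2 * d) (slices N h L)"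
    unfolding gram_mat_def osum_slices g(1) ..
  have "(\<Sum>f\<leftarrow>L. sqrt (wedge_total d N (h f))) \<le> (\<Sum>f\<leftarrow>L. (\<Sum>c<N. conc d (g f c)) + e)"
    using g(2) by (intro sum_list_mono) (smt (verit))
  also have "\<dots> = conc_sum d (slices N g L) + real (length L) * e"
    unfolding conc_sum_slices by (simp add: sum_list_addf sum_list_triv)
  also have "conc_sum d (slices N g L) \<le> neg_assist 2 d (gram_mat (2 * d) (slices N g L))"
    using assms(2) by (intro conc_sum_le_neg_assist) (simp only: eq)
  finally show ?thesis unfolding eq by simp
qed

text \<open>For each vector of a decomposition \<open>wedge_sq_split\<close> reads conc^2 = F_AB^2 +
  F_AC^2, so the concurrence is at most F_AB + F_AC. Summed over the list, each part is bounded by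
  \<open>slices_approx\<close>.\<close>

lemma neg_assist_polygamy:
  assumes "gram_state (2 * (dB * dC)) \<sigma>"
  shows "neg_assist 2 (dB * dC) \<sigma> \<le> neg_assist 2 dB (trace_C dB dC \<sigma>) + neg_assist 2 dC (trace_B dB dC \<sigma>)"
proof -
  obtain L0 where L0: "\<sigma> = gram_mat (2 * (dB * dC)) L0" "mtrace \<sigma> = 1"
    using assms unfolding gram_state_def by blast
  show ?thesis
    unfolding L0(1)
  proof (rule neg_assist_least)
    show "mtrace (gram_mat (2 * (dB * dC)) L0) = 1" using L0 by simp
    fix L assume L: "gram_mat (2 * (dB * dC)) L = gram_mat (2 * (dB * dC)) L0"
    let ?NB = "neg_assist 2 dB (trace_C dB dC (gram_mat (2 * (dB * dC)) L0))"
    let ?NC = "neg_assist 2 dC (trace_B dB dC (gram_mat (2 * (dB * dC)) L0))"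
    show "conc_sum (dB * dC) L \<le> ?NB + ?NC"
    proof (rule field_le_epsilon)
      fix \<epsilon> :: real assume "\<epsilon> > 0"
      \<comment> \<open>Each of the two sums costs \<open>length L\<close> slacks; the added 1 keeps
        the denominator positive for every list.\<close>
      define e where "e = \<epsilon> / (2 * (real (length L) + 1))"
      have e: "e > 0" "2 * (real (length L) * e) \<le> \<epsilon>" using \<open>\<epsilon> > 0\<close> by (auto simp: e_def field_simps)
      have "conc (dB * dC) f \<le> sqrt (wedge_total dB dC (sliceB dC f)) + sqrt (wedge_total dC dB (sliceC dB dC f))" for f
      proof -
        have "wedge_total d N h \<ge> 0" for d N h
          unfolding wedge_total_def by (intro sum_nonneg) auto
        then show ?thesis unfolding conc_def wedge_sq_split by (intro sqrt_add_le_add_sqrt) auto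
      qed
      then have "conc_sum (dB * dC) L \<le> (\<Sum>f\<leftarrow>L. sqrt (wedge_total dB dC (sliceB dC f)) + sqrt (wedge_total dC dB (sliceC dB dC f)))"
        unfolding conc_sum_def by (intro sum_list_mono)
      also have "\<dots> = (\<Sum>f\<leftarrow>L. sqrt (wedge_total dB dC (sliceB dC f))) + (\<Sum>f\<leftarrow>L. sqrt (wedge_total dC dB (sliceC dB dC f)))"
        by (rule sum_list_addf)
      also have "\<dots> \<le> (?NB + real (length L) * e) + (?NC + real (length L) * e)"
      proof (rule add_mono)
        have "mtrace (gram_mat (2 * dB) (slices dC (sliceB dC) L)) = 1"
          using L0 L mtrace_trace_C[of \<sigma> dB dC] by (simp flip: trace_C_gram_mat)
        from slices_approx[OF e(1) this]
        show "(\<Sum>f\<leftarrow>L. sqrt (wedge_total dB dC (sliceB dC f))) \<le> ?NB + real (length L) * e"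
          unfolding L[symmetric] trace_C_gram_mat .
        have "mtrace (gram_mat (2 * dC) (slices dB (sliceC dB dC) L)) = 1"
          using L0 L mtrace_trace_B[of \<sigma> dB dC] by (simp flip: trace_B_gram_mat)
        from slices_approx[OF e(1) this]
        show "(\<Sum>f\<leftarrow>L. sqrt (wedge_total dC dB (sliceC dB dC f))) \<le> ?NC + real (length L) * e"
          unfolding L[symmetric] trace_B_gram_mat .
      qed
      finally show "conc_sum (dB * dC) L \<le> ?NB + ?NC + \<epsilon>" using e(2) by linarith
    qed
  qed
qed

lemma density_gram_state:
  assumes "density D \<rho>"
  shows "gram_state D \<rho>"
proof -
  have psd: "psd D \<rho>" and tr: "mtrace \<rho> = 1" using assms unfolding density_def by auto
  obtain N f where f: "\<forall>i<D. \<forall>j<D. \<rho> $$ (i, j) = gram N f i j"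
    using nonneg_form_gram[OF psd_nonneg_form[OF psd]] by blast
  \<comment> \<open>A one-element list with a constant slicing function turns the family
    \<open>f\<close> into a list.\<close>
  have "\<rho> = gram_mat D (slices N (\<lambda>_. f) [undefined])"
    using psd f by (intro eq_matI) (auto simp: psd_def gram_mat_index osum_slices)
  then show ?thesis using tr unfolding gram_state_def by blast
qed

subsection \<open>Reduced states of qubit systems\<close>

definition bits_value :: "nat \<Rightarrow> nat list \<Rightarrow> nat \<Rightarrow> nat" where
  "bits_value n qs a = (\<Sum>t<length qs. qbit (length qs) a t * 2 ^ (n - 1 - qs ! t))"

lemma merge_idx_bits_value: "merge_idx n qs rs a c = bits_value n qs a + bits_value n rs c"
  by (simp add: merge_idx_def bits_value_def)

text \<open>Concatenation of qubit lists matches Kronecker indexing: the high digits of the index go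
  to \<open>qs\<close>, the low ones to \<open>rs\<close>.\<close>

lemma bits_value_append:
  assumes "b < 2 ^ length rs"
  shows "bits_value n (qs @ rs) (a * 2 ^ length rs + b) = bits_value n qs a + bits_value n rs b"
proof -
  let ?p = "length qs" and ?r = "length rs"
  have hi: "qbit (?p + ?r) (a * 2 ^ ?r + b) t = qbit ?p a t" if "t < ?p" for t
  proof -
    have "?p + ?r - 1 - t = ?r + (?p - 1 - t)" using that by simp
    then show ?thesis using assms by (simp add: qbit_def power_add div_mult2_eq)
  qed
  have lo: "qbit (?p + ?r) (a * 2 ^ ?r + b) (?p + t) = qbit ?r b t" if "t < ?r" for t
  proof -
    have e: "?r = Suc t + (?r - 1 - t)" using that by simp
    \<comment> \<open>After the shift the high part contributes a multiple of 2, which disappears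
      modulo 2.\<close>
    have "a * 2 ^ ?r + b = (a * 2 ^ t * 2) * 2 ^ (?r - 1 - t) + b"
      by (subst e) (simp only: power_add power_Suc mult_ac)
    then have "(a * 2 ^ ?r + b) div 2 ^ (?r - 1 - t) = a * 2 ^ t * 2 + b div 2 ^ (?r - 1 - t)"
      by (simp only: div_mult_self3 power_not_zero zero_neq_numeral not_False_eq_True)
    moreover have "?p + ?r - 1 - (?p + t) = ?r - 1 - t" by simp
    ultimately show ?thesis unfolding qbit_def by (metis mod_mult_self3)
  qed
  have "{..<?p + ?r} = {..<?p} \<union> {?p..<?p + ?r}" by auto
  then have "bits_value n (qs @ rs) (a * 2 ^ ?r + b)
     = (\<Sum>t<?p. qbit (?p + ?r) (a * 2 ^ ?r + b) t * 2 ^ (n - 1 - (qs @ rs) ! t))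
     + (\<Sum>t=?p..<?p + ?r. qbit (?p + ?r) (a * 2 ^ ?r + b) t * 2 ^ (n - 1 - (qs @ rs) ! t))"
    unfolding bits_value_def by (simp add: sum.union_disjoint ivl_disj_int)
  also have "(\<Sum>t=?p..<?p + ?r. qbit (?p + ?r) (a * 2 ^ ?r + b) t * 2 ^ (n - 1 - (qs @ rs) ! t))
     = (\<Sum>t<?r. qbit (?p + ?r) (a * 2 ^ ?r + b) (?p + t) * 2 ^ (n - 1 - (qs @ rs) ! (?p + t)))"
    using sum.shift_bounds_nat_ivl[of "\<lambda>t. qbit (?p + ?r) (a * 2 ^ ?r + b) t * 2 ^ (n - 1 - (qs @ rs) ! t)" 0 ?p ?r]
    by (simp add: atLeast0LessThan add.commute)
  finally show ?thesis by (simp add: hi lo nth_append bits_value_def)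
qed

lemma bits_value_single: "a < 2 \<Longrightarrow> bits_value n [p] a = a * 2 ^ (n - 1 - p)"
  by (simp add: bits_value_def qbit_def)

text \<open>Contiguous qubits hold a binary number, shifted by the n - p - m qubits after them. The
  induction splits off the last bit.\<close>

lemma bits_value_block:
  "a < 2 ^ m \<Longrightarrow> p + m \<le> n \<Longrightarrow> bits_value n [p..<p + m] a = a * 2 ^ (n - p - m)"
proof (induction m arbitrary: a)
  case 0
  then show ?case by (simp add: bits_value_def)
next
  case (Suc m)
  have "bits_value n [p..<p + Suc m] a = bits_value n ([p..<p + m] @ [p + m]) (a div 2 * 2 ^ length [p + m] + a mod 2)"
    by simp
  also have "\<dots> = bits_value n [p..<p + m] (a div 2) + bits_value n [p + m] (a mod 2)"
    by (rule bits_value_append) simp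
  also have "bits_value n [p..<p + m] (a div 2) = a div 2 * 2 ^ (n - p - m)"
    using Suc by (intro Suc.IH) auto
  also have "bits_value n [p + m] (a mod 2) = a mod 2 * 2 ^ (n - p - Suc m)"
    by (subst bits_value_single) (auto simp: diff_diff_eq)
  also have "n - p - m = Suc (n - p - Suc m)" using Suc.prems by simp
  also have "a div 2 * 2 ^ Suc (n - p - Suc m) + a mod 2 * 2 ^ (n - p - Suc m) = (a div 2 * 2 + a mod 2) * 2 ^ (n - p - Suc m)"
    by (simp only: power_Suc distrib_right mult.assoc)
  finally show ?case by simp
qed

text \<open>The discarded qubits 1 to t - 1 sit between qubit 0 and the kept tail, so their value
  \<open>c\<close> is inserted between the first bit of \<open>a\<close> and the rest.\<close>

lemma merge_idx_tail:
  assumes "1 \<le> t" "t \<le> n" "a < 2 * 2 ^ (n - t)" "c < 2 ^ (t - 1)"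
  shows "merge_idx n (0 # [t..<n]) [1..<t] a c
    = a div 2 ^ (n - t) * 2 ^ (n - 1) + c * 2 ^ (n - t) + a mod 2 ^ (n - t)"
proof -
  have "bits_value n (0 # [t..<n]) a = bits_value n ([0] @ [t..<n]) (a div 2 ^ (n - t) * 2 ^ length [t..<n] + a mod 2 ^ (n - t))"
    by (simp add: div_mult_mod_eq)
  also have "\<dots> = bits_value n [0] (a div 2 ^ (n - t)) + bits_value n [t..<n] (a mod 2 ^ (n - t))"
    by (rule bits_value_append) simp
  also have "bits_value n [0] (a div 2 ^ (n - t)) = a div 2 ^ (n - t) * 2 ^ (n - 1)"
    using assms(3) by (subst bits_value_single) (auto simp: less_mult_imp_div_less)
  also have "bits_value n [t..<n] (a mod 2 ^ (n - t)) = a mod 2 ^ (n - t)"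
    using bits_value_block[of "a mod 2 ^ (n - t)" "n - t" t n] assms by simp
  finally have "bits_value n (0 # [t..<n]) a = a div 2 ^ (n - t) * 2 ^ (n - 1) + a mod 2 ^ (n - t)" .
  moreover have "bits_value n [1..<t] c = c * 2 ^ (n - t)"
    using bits_value_block[of c "t - 1" 1 n] assms by simp
  ultimately show ?thesis unfolding merge_idx_bits_value by simp
qed

text \<open>Discarded qubits lie on both sides of qubit \<open>t\<close>: \<open>c\<close> holds
  those before it, \<open>e\<close> those after it.\<close>

lemma merge_idx_pair:
  assumes "1 \<le> t" "t < n" "a < 4" "c < 2 ^ (t - 1)" "e < 2 ^ (n - 1 - t)"
  shows "merge_idx n [0, t] ([1..<t] @ [t + 1..<n]) a (c * 2 ^ (n - 1 - t) + e)
    = a div 2 * 2 ^ (n - 1) + c * 2 ^ (n - t) + a mod 2 * 2 ^ (n - 1 - t) + e"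
proof -
  have "bits_value n [0, t] a = bits_value n ([0] @ [t]) (a div 2 * 2 ^ length [t] + a mod 2)"
    by simp
  also have "\<dots> = bits_value n [0] (a div 2) + bits_value n [t] (a mod 2)"
    by (rule bits_value_append) simp
  also have "\<dots> = a div 2 * 2 ^ (n - 1) + a mod 2 * 2 ^ (n - 1 - t)"
    using assms(3) by (simp add: bits_value_single less_mult_imp_div_less)
  finally have 1: "bits_value n [0, t] a = a div 2 * 2 ^ (n - 1) + a mod 2 * 2 ^ (n - 1 - t)" .
  have "bits_value n ([1..<t] @ [t + 1..<n]) (c * 2 ^ length [t + 1..<n] + e)
     = bits_value n [1..<t] c + bits_value n [t + 1..<n] e"
    using assms by (intro bits_value_append) simp
  moreover have "bits_value n [1..<t] c = c * 2 ^ (n - t)"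
    using bits_value_block[of c "t - 1" 1 n] assms by simp
  moreover have "bits_value n [t + 1..<n] e = e"
    using bits_value_block[of e "n - 1 - t" "t + 1" n] assms by simp
  ultimately show ?thesis unfolding merge_idx_bits_value 1 by simp
qed

section \<open>Explicit reduced states on a pair and on a tail\<close>

lemma sorted_list_of_set_tail: "1 \<le> (t::nat) \<Longrightarrow> sorted_list_of_set ({0} \<union> {t..<n}) = 0 # [t..<n]"
  using sorted_list_of_set.idem_if_sorted_distinct[of "0 # [t..<n]"] by simp

lemma sorted_list_of_set_tail_compl:
  "1 \<le> t \<Longrightarrow> t \<le> n \<Longrightarrow> sorted_list_of_set ({0..<n} - ({0} \<union> {t..<n})) = [1..<t]"
proof -
  assume "1 \<le> t" "t \<le> n"
  then have "{0..<n} - ({0} \<union> {t..<n}) = {1..<t}" by auto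
  then show ?thesis by (simp only: sorted_list_of_set_range)
qed

lemma sorted_list_of_set_pair: "1 \<le> (t::nat) \<Longrightarrow> sorted_list_of_set {0, t} = [0, t]"
proof -
  assume "1 \<le> t"
  then have "{t} - {0} = {t}" by auto
  then show ?thesis by simp
qed

lemma sorted_list_of_set_pair_compl:
  assumes "1 \<le> t" "t < n"
  shows "sorted_list_of_set ({0..<n} - {0, t}) = [1..<t] @ [t + 1..<n]"
proof -
  have "{0..<n} - {0, t} = set ([1..<t] @ [t + 1..<n])" using assms by auto
  moreover have "sorted ([1..<t] @ [t + 1..<n])" "distinct ([1..<t] @ [t + 1..<n])"
    by (auto simp: sorted_append)
  ultimately show ?thesis by (metis sorted_list_of_set.idem_if_sorted_distinct)
qed

lemma reduced_tail:
  assumes "1 \<le> t" "t \<le> n"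
  shows "reduced n ({0} \<union> {t..<n}) \<rho> = mat (2 * 2 ^ (n - t)) (2 * 2 ^ (n - t)) (\<lambda>(a, b). \<Sum>c<2 ^ (t - 1).
    \<rho> $$ (a div 2 ^ (n - t) * 2 ^ (n - 1) + c * 2 ^ (n - t) + a mod 2 ^ (n - t),
          b div 2 ^ (n - t) * 2 ^ (n - 1) + c * 2 ^ (n - t) + b mod 2 ^ (n - t)))"
  unfolding reduced_def Let_def sorted_list_of_set_tail[OF assms(1)] sorted_list_of_set_tail_compl[OF assms]
  by (intro cong_mat) (simp_all add: merge_idx_tail[OF assms] del: One_nat_def)

lemma reduced_pair:
  assumes "1 \<le> t" "t < n"
  shows "reduced n {0, t} \<rho> = mat 4 4 (\<lambda>(a, b). \<Sum>c<2 ^ (t - 1). \<Sum>e<2 ^ (n - 1 - t).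
    \<rho> $$ (a div 2 * 2 ^ (n - 1) + c * 2 ^ (n - t) + a mod 2 * 2 ^ (n - 1 - t) + e,
          b div 2 * 2 ^ (n - 1) + c * 2 ^ (n - t) + b mod 2 * 2 ^ (n - 1 - t) + e))"
proof -
  have "length ([1..<t] @ [t + 1..<n]) = (t - 1) + (n - 1 - t)" using assms by simp
  then have len: "(2::nat) ^ length ([1..<t] @ [t + 1..<n]) = 2 ^ (t - 1) * 2 ^ (n - 1 - t)"
    by (simp only: power_add)
  show ?thesis
    unfolding reduced_def Let_def sorted_list_of_set_pair[OF assms(1)] sorted_list_of_set_pair_compl[OF assms]
      len sum_mult_split
    by (intro cong_mat) (simp_all add: merge_idx_pair[OF assms, simplified])
qed

lemma two_power_diff: "t < n \<Longrightarrow> (2::nat) ^ (n - t) = 2 * 2 ^ (n - 1 - t)"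
  by (metis Suc_diff_Suc diff_Suc_eq_diff_pred power_Suc)

section \<open>Partial traces of the tail states\<close>

context
  fixes n t :: nat
  assumes t: "1 \<le> t" "t < n"
begin

text \<open>Here A is qubit 0, B is qubit \<open>t\<close> and C consists of the qubits after
  \<open>t\<close>, so discarding C leaves the pair.\<close>

lemma trace_C_reduced_tail:
  "trace_C 2 (2 ^ (n - 1 - t)) (reduced n ({0} \<union> {t..<n}) \<rho>) = reduced n {0, t} \<rho>"
  unfolding trace_C_def reduced_pair[OF t]
proof (intro cong_mat)
  fix i j :: nat assume ij: "i < 2 * 2" "j < 2 * 2"
  let ?K = "2 ^ (n - 1 - t) :: nat"
  have idx: "i * ?K + y < 2 * 2 ^ (n - t)" "(i * ?K + y) div 2 ^ (n - t) = i div 2"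
    "(i * ?K + y) mod 2 ^ (n - t) = i mod 2 * ?K + y" if "y < ?K" "i < 2 * 2" for i y
  proof -
    show "i * ?K + y < 2 * 2 ^ (n - t)"
      unfolding two_power_diff[OF t(2)] using mult_add_less[OF that(2,1)] by simp
    have lt: "i mod 2 * ?K + y < 2 * ?K" using that(1) by (intro mult_add_less) auto
    have eq: "i * ?K + y = i div 2 * (2 * ?K) + (i mod 2 * ?K + y)"
      by (subst div_mult_mod_eq[of i 2, symmetric]) (simp only: distrib_right mult.assoc add.assoc)
    show "(i * ?K + y) div 2 ^ (n - t) = i div 2" "(i * ?K + y) mod 2 ^ (n - t) = i mod 2 * ?K + y"
      unfolding two_power_diff[OF t(2)] eq using lt by simp_all
  qed
  show "(case (i, j) of (i, j) \<Rightarrow> \<Sum>y<?K. reduced n ({0} \<union> {t..<n}) \<rho> $$ (i * ?K + y, j * ?K + y))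
    = (case (i, j) of (a, b) \<Rightarrow> \<Sum>c<2 ^ (t - 1). \<Sum>e<?K.
    \<rho> $$ (a div 2 * 2 ^ (n - 1) + c * 2 ^ (n - t) + a mod 2 * ?K + e,
          b div 2 * 2 ^ (n - 1) + c * 2 ^ (n - t) + b mod 2 * ?K + e))"
    unfolding reduced_tail[OF t(1) less_imp_le[OF t(2)]] prod.case
  proof (subst sum.swap[of _ _ "{..<2 ^ (t - 1)}"], intro sum.cong[OF refl], goal_cases)
    case (1 y)
    then have y: "y < ?K" by simp
    show ?case
      unfolding index_mat(1)[OF idx(1)[OF y ij(1)] idx(1)[OF y ij(2)]] prod.case
        idx(2,3)[OF y ij(1)] idx(2,3)[OF y ij(2)] by (simp only: add.assoc)
  qed
qed simp_all

text \<open>Discarding B adds qubit \<open>t\<close> to the discarded block, whose index becomes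
  \<open>c * 2 + e\<close> with \<open>e\<close> the bit of qubit \<open>t\<close>.\<close>

lemma trace_B_reduced_tail:
  "trace_B 2 (2 ^ (n - 1 - t)) (reduced n ({0} \<union> {t..<n}) \<rho>) = reduced n ({0} \<union> {t + 1..<n}) \<rho>"
proof -
  let ?K = "2 ^ (n - 1 - t) :: nat"
  have K: "2 ^ (n - (t + 1)) = ?K" by simp
  have M: "(2::nat) ^ (t + 1 - 1) = 2 ^ (t - 1) * 2" using t by (cases t) simp_all
  have t': "1 \<le> t + 1" "t + 1 \<le> n" using t by simp_all
  show ?thesis
    unfolding trace_B_def reduced_tail[OF t'] K M sum_mult_split
  proof (intro cong_mat)
    fix i j :: nat assume ij: "i < 2 * ?K" "j < 2 * ?K"
    have idx: "i div ?K * (2 * ?K) + b * ?K + i mod ?K < 2 * 2 ^ (n - t)"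
      "(i div ?K * (2 * ?K) + b * ?K + i mod ?K) div 2 ^ (n - t) = i div ?K"
      "(i div ?K * (2 * ?K) + b * ?K + i mod ?K) mod 2 ^ (n - t) = b * ?K + i mod ?K"
      if "b < 2" "i < 2 * ?K" for b i
    proof -
      show "i div ?K * (2 * ?K) + b * ?K + i mod ?K < 2 * 2 ^ (n - t)"
        unfolding two_power_diff[OF t(2)] using index_B_less[OF that(2,1)] by simp
      have lt: "b * ?K + i mod ?K < 2 * ?K" using that(1) by (intro mult_add_less) auto
      then show "(i div ?K * (2 * ?K) + b * ?K + i mod ?K) div 2 ^ (n - t) = i div ?K"
        "(i div ?K * (2 * ?K) + b * ?K + i mod ?K) mod 2 ^ (n - t) = b * ?K + i mod ?K"
        unfolding two_power_diff[OF t(2)] add.assoc by simp_all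
    qed
    show "(case (i, j) of (i, j) \<Rightarrow> \<Sum>b<2. reduced n ({0} \<union> {t..<n}) \<rho> $$
        (i div ?K * (2 * ?K) + b * ?K + i mod ?K, j div ?K * (2 * ?K) + b * ?K + j mod ?K))
      = (case (i, j) of (a, b) \<Rightarrow> \<Sum>c<2 ^ (t - 1). \<Sum>e<2.
         \<rho> $$ (a div ?K * 2 ^ (n - 1) + (c * 2 + e) * ?K + a mod ?K,
            b div ?K * 2 ^ (n - 1) + (c * 2 + e) * ?K + b mod ?K))"
      unfolding reduced_tail[OF t(1) less_imp_le[OF t(2)]] prod.case
    proof (subst sum.swap[of _ _ "{..<2 ^ (t - 1)}"], intro sum.cong[OF refl], goal_cases)
      case (1 b)
      then have b: "b < 2" by simp
      show ?case
        unfolding index_mat(1)[OF idx(1)[OF b ij(1)] idx(1)[OF b ij(2)]] prod.case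
          idx(2,3)[OF b ij(1)] idx(2,3)[OF b ij(2)]
        by (simp only: two_power_diff[OF t(2)] distrib_right add.assoc mult.assoc)
    qed
  qed simp_all
qed

end

lemma reduced_all:
  assumes "\<rho> \<in> carrier_mat (2 ^ n) (2 ^ n)" "1 \<le> n"
  shows "reduced n ({0} \<union> {1..<n}) \<rho> = \<rho>"
proof -
  have "(2::nat) * 2 ^ (n - 1) = 2 ^ n" using assms(2) by (cases n) simp_all
  then show ?thesis
    unfolding reduced_tail[OF order_refl assms(2)] using assms(1)
    by (intro eq_matI) (auto simp: div_mult_mod_eq)
qed

text \<open>Starting from the full state at t = 1, each tail state is a partial trace of the one
  before.\<close>

lemma gram_state_reduced_tail:
  assumes "density (2 ^ n) \<rho>" "1 \<le> t" "t \<le> n"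
  shows "gram_state (2 * 2 ^ (n - t)) (reduced n ({0} \<union> {t..<n}) \<rho>)"
  using assms(2,3)
proof (induction t rule: nat_induct_at_least)
  case base
  have "(2::nat) * 2 ^ (n - 1) = 2 ^ n" using base by (cases n) simp_all
  moreover have "\<rho> \<in> carrier_mat (2 ^ n) (2 ^ n)" using assms(1) by (simp add: density_def psd_def)
  ultimately show ?case using density_gram_state[OF assms(1)] reduced_all[of \<rho> n] base by simp
next
  case (Suc t)
  then have t: "1 \<le> t" "t < n" by simp_all
  have "gram_state (2 * (2 * 2 ^ (n - 1 - t))) (reduced n ({0} \<union> {t..<n}) \<rho>)"
    using Suc two_power_diff[OF t(2)] by simp
  from gram_state_trace_B[OF this] show ?case
    unfolding trace_B_reduced_tail[OF t] by simp
qed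

lemma NA_tail: "1 \<le> t \<Longrightarrow> NA n \<rho> ({0} \<union> {t..<n}) = neg_assist 2 (2 ^ (n - t)) (reduced n ({0} \<union> {t..<n}) \<rho>)"
  by (simp add: NA_def)

lemma NA_pair: "1 \<le> t \<Longrightarrow> NA n \<rho> {0, t} = neg_assist 2 2 (reduced n {0, t} \<rho>)"
  by (simp add: NA_def)

lemma NA_tail_nonneg:
  assumes "density (2 ^ n) \<rho>" "1 \<le> t" "t \<le> n"
  shows "NA n \<rho> ({0} \<union> {t..<n}) \<ge> 0"
  unfolding NA_tail[OF assms(2)] by (intro gram_state_neg_assist_nonneg gram_state_reduced_tail assms)

lemma NA_pair_nonneg_and_polygamy:
  assumes "density (2 ^ n) \<rho>" "1 \<le> t" "t < n"
  shows "NA n \<rho> {0, t} \<ge> 0"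
    and "NA n \<rho> ({0} \<union> {t..<n}) \<le> NA n \<rho> {0, t} + NA n \<rho> ({0} \<union> {t + 1..<n})"
proof -
  note p = two_power_diff[OF assms(3)]
  have g: "gram_state (2 * (2 * 2 ^ (n - 1 - t))) (reduced n ({0} \<union> {t..<n}) \<rho>)"
    using gram_state_reduced_tail[of n \<rho> t] assms p by simp
  show "NA n \<rho> {0, t} \<ge> 0"
    unfolding NA_pair[OF assms(2)] trace_C_reduced_tail[OF assms(2,3), symmetric]
    by (intro gram_state_neg_assist_nonneg gram_state_trace_C g)
  have "NA n \<rho> ({0} \<union> {t + 1..<n}) = neg_assist 2 (2 ^ (n - 1 - t)) (reduced n ({0} \<union> {t + 1..<n}) \<rho>)"
    by (subst NA_tail) simp_all
  then show "NA n \<rho> ({0} \<union> {t..<n}) \<le> NA n \<rho> {0, t} + NA n \<rho> ({0} \<union> {t + 1..<n})"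
    using neg_assist_polygamy[OF g]
    unfolding NA_tail[OF assms(2)] NA_pair[OF assms(2)] trace_C_reduced_tail[OF assms(2,3)]
      trace_B_reduced_tail[OF assms(2,3)] p by simp
qed

subsection \<open>Power inequalities\<close>

lemma powr_le_self: "0 \<le> x \<Longrightarrow> x \<le> 1 \<Longrightarrow> 1 \<le> t \<Longrightarrow> x powr t \<le> (x::real)"
  using powr_mono'[of 1 t x] by (cases "x = 0") auto

lemma self_le_powr: "0 \<le> x \<Longrightarrow> x \<le> 1 \<Longrightarrow> s \<le> 1 \<Longrightarrow> x \<le> (x::real) powr s"
  using powr_mono'[of s 1 x] by (cases "x = 0") auto

text \<open>After division by x + y the two fractions sum to 1, and a number in [0,1] is at most its
  power with exponent at most 1.\<close>

lemma powr_subadditive: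
  fixes x y s :: real
  assumes "0 \<le> x" "0 \<le> y" "s \<le> 1"
  shows "(x + y) powr s \<le> x powr s + y powr s"
proof (cases "x + y = 0")
  case True then show ?thesis using assms by auto
next
  case False
  then have p: "x + y > 0" using assms by auto
  have "1 = x / (x + y) + y / (x + y)" using p by (simp add: add_divide_distrib[symmetric])
  also have "\<dots> \<le> (x / (x + y)) powr s + (y / (x + y)) powr s"
    using assms p by (intro add_mono self_le_powr) auto
  also have "\<dots> = (x powr s + y powr s) / (x + y) powr s"
    using assms p by (simp add: powr_divide add_divide_distrib)
  finally show ?thesis using p by (simp add: le_divide_eq_1)
qed

lemma powr_superadditive:
  fixes x y t :: real
  assumes "0 \<le> x" "0 \<le> y" "1 \<le> t"
  shows "x powr t + y powr t \<le> (x + y) powr t"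
proof (cases "x + y = 0")
  case True
  then have "x = 0" "y = 0" using assms by linarith+
  then show ?thesis by simp
next
  case False
  then have p: "x + y > 0" using assms by auto
  have "(x powr t + y powr t) / (x + y) powr t = (x / (x + y)) powr t + (y / (x + y)) powr t"
    using assms p by (simp add: powr_divide add_divide_distrib)
  also have "\<dots> \<le> x / (x + y) + y / (x + y)"
    using assms p by (intro add_mono powr_le_self) auto
  also have "\<dots> = 1" using p by (simp add: add_divide_distrib[symmetric])
  finally show ?thesis using p by (simp add: divide_le_eq_1)
qed

lemma powr_shift_diff_mono:
  fixes u w t :: real
  assumes "0 \<le> u" "u \<le> w" "1 \<le> t"
  shows "(1 + u) powr t - u powr t \<le> (1 + w) powr t - w powr t"
\<comment> \<open>The derivative rule for \<open>powr\<close> asks for a positive base; at u = 0 the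
  claim is superadditivity.\<close>
proof (cases "u = 0")
  case True
  then show ?thesis using powr_superadditive[of 1 w t] assms by simp
next
  case False
  show ?thesis
  proof (rule DERIV_nonneg_imp_nondecreasing[OF assms(2)])
    fix x assume x: "u \<le> x" "x \<le> w"
    then have "((\<lambda>x. (1 + x) powr t - x powr t) has_real_derivative
        t * (1 + x) powr (t - 1) - t * x powr (t - 1)) (at x)"
      using False assms by (auto intro!: derivative_eq_intros)
    moreover have "x powr (t - 1) \<le> (1 + x) powr (t - 1)" using x assms by (intro powr_mono2) auto
    then have "0 \<le> t * (1 + x) powr (t - 1) - t * x powr (t - 1)"
      using assms by (simp add: mult_left_mono)
    ultimately show "\<exists>y. ((\<lambda>x. (1 + x) powr t - x powr t) has_real_derivative y) (at x) \<and> 0 \<le> y"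
      by blast
  qed
qed

text \<open>For Y > 0, division by Y^t leaves u = X/Y in [0, 1/k], and the coefficient of Y^t is the
  value of (1 + u)^t - q^t u^t at the endpoint 1/k.\<close>

lemma powr_add_weighted_bound:
  fixes X Y k q t :: real
  assumes "0 \<le> X" "k * X \<le> Y" "k \<ge> 1" "0 < q" "q \<le> 1" "1 \<le> t"
  shows "(X + Y) powr t \<le> q powr t * X powr t + ((1 + k) powr t - q powr t) / k powr t * Y powr t"
proof (cases "Y = 0")
  case True
  then have "X = 0" using assms by (simp add: mult_le_0_iff)
  then show ?thesis using True by simp
next
  case False
  have "0 \<le> k * X" using assms by simp
  then have Y: "Y > 0" using assms False by linarith
  define u where "u = X / Y"
  have u: "0 \<le> u" "u \<le> 1 / k" using assms Y by (auto simp: u_def field_simps)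
  \<comment> \<open>As q^t \<le> 1, the term q^t u^t grows no faster than u^t, which reduces the
    monotonicity to \<open>powr_shift_diff_mono\<close>.\<close>
  have "q powr t * (1 / k) powr t - q powr t * u powr t \<le> (1 / k) powr t - u powr t"
  proof -
    have "u powr t \<le> (1 / k) powr t" using u assms by (intro powr_mono2) auto
    moreover have "q powr t \<le> 1" using assms by (intro powr_le1) auto
    ultimately show ?thesis
      unfolding right_diff_distrib[symmetric] by (intro mult_left_le_one_le) auto
  qed
  then have "(1 + u) powr t - q powr t * u powr t \<le> (1 + 1 / k) powr t - q powr t * (1 / k) powr t"
    using powr_shift_diff_mono[OF u assms(6)] by linarith
  also have "(1 + 1 / k) powr t = (1 + k) powr t / k powr t"
    using assms by (simp add: powr_divide[symmetric] add_divide_distrib add.commute)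
  also have "(1 + k) powr t / k powr t - q powr t * (1 / k) powr t = ((1 + k) powr t - q powr t) / k powr t"
    using assms by (simp add: powr_divide diff_divide_distrib)
  finally have "(1 + u) powr t \<le> q powr t * u powr t + ((1 + k) powr t - q powr t) / k powr t" by simp
  then have "(1 + u) powr t * Y powr t \<le> (q powr t * u powr t + ((1 + k) powr t - q powr t) / k powr t) * Y powr t"
    by (rule mult_right_mono) simp
  moreover have "(1 + u) * Y = X + Y" "u * Y = X" using Y by (simp_all add: u_def distrib_right)
  then have "(1 + u) powr t * Y powr t = (X + Y) powr t" "u powr t * Y powr t = X powr t"
    using u Y by (simp_all add: powr_mult[symmetric])
  ultimately show ?thesis by (simp add: distrib_right mult.assoc)
qed

lemma weight_ge_one:
  fixes k q t :: real
  assumes "k \<ge> 1" "0 < q" "q \<le> 1" "1 \<le> t"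
  shows "((1 + k) powr t - q powr t) / k powr t \<ge> 1"
proof -
  have "q powr t \<le> 1" using assms by (intro powr_le1) auto
  then have "k powr t \<le> (1 + k) powr t - q powr t"
    using powr_superadditive[of 1 k t] assms by simp
  then show ?thesis using assms by (simp add: le_divide_eq_1)
qed

text \<open>The weighted bound is applied to X = x^s and Y = y^s with exponent \<beta>/s; since s
  \<le> 1, subadditivity carries z \<le> x + y over to the powers.\<close>

lemma powr_polygamy_step:
  fixes x y z k q s \<beta> :: real
  assumes "0 \<le> x" "0 \<le> y" "0 \<le> z" "z \<le> x + y" "k * x powr s \<le> y powr s"
    and "k \<ge> 1" "0 < q" "q \<le> 1" "0 < s" "s \<le> 1" "s \<le> \<beta>"
  shows "z powr \<beta> \<le> q powr (\<beta> / s) * x powr \<beta>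
    + ((1 + k) powr (\<beta> / s) - q powr (\<beta> / s)) / k powr (\<beta> / s) * y powr \<beta>"
proof -
  have t: "1 \<le> \<beta> / s" using assms by simp
  have conv: "(w powr s) powr (\<beta> / s) = w powr \<beta>" for w
    using assms by (simp add: powr_powr)
  have "z powr s \<le> (x + y) powr s" using assms by (intro powr_mono2) auto
  also have "\<dots> \<le> x powr s + y powr s" using assms by (intro powr_subadditive) auto
  finally have "(z powr s) powr (\<beta> / s) \<le> (x powr s + y powr s) powr (\<beta> / s)"
    using t by (intro powr_mono2) auto
  also have "\<dots> \<le> q powr (\<beta> / s) * (x powr s) powr (\<beta> / s)
    + ((1 + k) powr (\<beta> / s) - q powr (\<beta> / s)) / k powr (\<beta> / s) * (y powr s) powr (\<beta> / s)"
    using assms t by (intro powr_add_weighted_bound) auto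
  finally show ?thesis unfolding conv .
qed

section \<open>Iterating the polygamy relation along the chain\<close>

context
  fixes P T :: "nat \<Rightarrow> real" and n :: nat and k q s \<beta> l :: real
  assumes nonneg: "\<And>i. 2 \<le> i \<Longrightarrow> i \<le> n \<Longrightarrow> P i \<ge> 0" "\<And>i. 1 \<le> i \<Longrightarrow> i < n \<Longrightarrow> T i \<ge> 0"
    and polygamy: "\<And>i. 2 \<le> i \<Longrightarrow> i < n \<Longrightarrow> T (i - 1) \<le> P i + T i"
    and k: "k \<ge> 1" and q: "0 < q" "q \<le> 1" and s: "0 < s" "s \<le> 1" and \<beta>: "\<beta> \<ge> s"
    and l_def: "l = ((1 + k) powr (\<beta> / s) - q powr (\<beta> / s)) / k powr (\<beta> / s)"
begin

lemma l_ge_1: "l \<ge> 1"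
  unfolding l_def using k q s \<beta> by (intro weight_ge_one) auto

text \<open>At each step the pair is the smaller term and takes the q-factor, while the tail takes
  \<open>l\<close>. So every pair carries one q-factor, and a power of \<open>l\<close> counting the
  earlier steps.\<close>

lemma increasing_chain:
  assumes "1 \<le> m" "m < n" "\<forall>i\<in>{2..m}. k * P i powr s \<le> T i powr s"
  shows "T 1 powr \<beta> \<le> q powr (\<beta> / s) * (\<Sum>i=2..m. l ^ (i - 2) * P i powr \<beta>) + l ^ (m - 1) * T m powr \<beta>"
  using assms
proof (induction m rule: nat_induct_at_least)
  case base
  then show ?case by simp
next
  case (Suc m)
  have IH: "T 1 powr \<beta> \<le> q powr (\<beta> / s) * (\<Sum>i=2..m. l ^ (i - 2) * P i powr \<beta>) + l ^ (m - 1) * T m powr \<beta>"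
    using Suc by auto
  have "T m powr \<beta> \<le> q powr (\<beta> / s) * P (Suc m) powr \<beta> + l * T (Suc m) powr \<beta>"
    unfolding l_def using Suc polygamy[of "Suc m"] nonneg k q s \<beta> by (intro powr_polygamy_step) auto
  then have "l ^ (m - 1) * T m powr \<beta> \<le> l ^ (m - 1) * (q powr (\<beta> / s) * P (Suc m) powr \<beta> + l * T (Suc m) powr \<beta>)"
    using l_ge_1 by (intro mult_left_mono) auto
  also have "\<dots> = q powr (\<beta> / s) * (l ^ (Suc m - 2) * P (Suc m) powr \<beta>) + l ^ (Suc m - 1) * T (Suc m) powr \<beta>"
    using Suc.hyps by (cases m) (simp_all add: algebra_simps)
  finally show ?case using IH Suc.hyps by (simp add: distrib_left)
qed

text \<open>The roles are exchanged: the tail is the smaller term and collects the q-factors, and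
  each pair takes \<open>l\<close> exactly once.\<close>

lemma decreasing_chain:
  assumes "m \<le> r" "1 \<le> m" "r < n" "\<forall>j\<in>{m+1..r}. P j powr s \<ge> k * T j powr s"
  shows "T m powr \<beta> \<le> l * (\<Sum>j=m+1..r. q powr (real (j - m - 1) * \<beta> / s) * P j powr \<beta>)
     + q powr (real (r - m) * \<beta> / s) * T r powr \<beta>"
  using assms
proof (induction r rule: nat_induct_at_least)
  case base
  then show ?case using q by simp
next
  case (Suc r)
  let ?Q = "q powr (real (r - m) * \<beta> / s)"
  have IH: "T m powr \<beta> \<le> l * (\<Sum>j=m+1..r. q powr (real (j - m - 1) * \<beta> / s) * P j powr \<beta>) + ?Q * T r powr \<beta>"
    using Suc by auto
  have "T r powr \<beta> \<le> q powr (\<beta> / s) * T (Suc r) powr \<beta> + l * P (Suc r) powr \<beta>"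
    unfolding l_def using Suc polygamy[of "Suc r"] nonneg k q s \<beta> by (intro powr_polygamy_step) auto
  then have "?Q * T r powr \<beta> \<le> ?Q * (q powr (\<beta> / s) * T (Suc r) powr \<beta> + l * P (Suc r) powr \<beta>)"
    by (intro mult_left_mono) auto
  also have "\<dots> = l * (?Q * P (Suc r) powr \<beta>) + (?Q * q powr (\<beta> / s)) * T (Suc r) powr \<beta>"
    by (simp add: algebra_simps)
  also have "?Q * q powr (\<beta> / s) = q powr (real (Suc r - m) * \<beta> / s)"
    using Suc.hyps by (simp add: powr_add[symmetric] Suc_diff_le add_divide_distrib distrib_right add.commute)
  also have "?Q = q powr (real (Suc r - m - 1) * \<beta> / s)" using Suc.hyps by (simp add: Suc_diff_le)
  finally show ?case using IH Suc.hyps by (simp add: distrib_left)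
qed

end

theorem theorem5:
  fixes n :: nat and \<rho> :: "complex mat" and k q s \<beta> l :: real
  assumes state: "density (2 ^ n) \<rho>"
    and k: "k \<ge> 1" and q: "0 < q" "q \<le> 1" and s: "0 < s" "s \<le> 1" and \<beta>: "\<beta> \<ge> s"
    and l_def: "l = ((1 + k) powr (\<beta> / s) - q powr (\<beta> / s)) / k powr (\<beta> / s)"
  defines "P \<equiv> (\<lambda>i::nat. NA n \<rho> {0, i - 1})"
    and "T \<equiv> (\<lambda>j::nat. NA n \<rho> ({0} \<union> {j..<n}))"
  shows
   "(\<forall>m. 4 \<le> n \<and> 2 \<le> m \<and> m \<le> n - 2 \<and>
        (\<forall>i\<in>{2..m}. k * P i powr s \<le> T i powr s) \<and>
        (\<forall>j\<in>{m+1..n-1}. P j powr s \<ge> k * T j powr s) \<longrightarrow>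
      T 1 powr \<beta> \<le>
        q powr (\<beta> / s) * (\<Sum>i=2..m. l ^ (i - 2) * P i powr \<beta>)
        + l ^ m * (\<Sum>j=m+1..n-1. q powr (real (j - m - 1) * \<beta> / s) * P j powr \<beta>)
        + l ^ (m - 1) * q powr (real (n - m - 1) * \<beta> / s) * P n powr \<beta>)
    \<and>
    (3 \<le> n \<and> (\<forall>i\<in>{2..n-1}. k * P i powr s \<le> T i powr s) \<longrightarrow>
      T 1 powr \<beta> \<le>
        q powr (\<beta> / s) * (\<Sum>i=2..n-1. l ^ (i - 2) * P i powr \<beta>)
        + l ^ (n - 2) * P n powr \<beta>)
    \<and>
    (3 \<le> n \<and> (\<forall>j\<in>{2..n-1}. P j powr s \<ge> k * T j powr s) \<longrightarrow>
      T 1 powr \<beta> \<le>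
        l * (\<Sum>j=2..n-1. q powr (real (j - 2) * \<beta> / s) * P j powr \<beta>)
        + q powr (real (n - 2) * \<beta> / s) * P n powr \<beta>)"
proof -
  \<comment> \<open>Qubits are numbered from 0: qubit i - 1 is A_i, and the tail from qubit
    \<open>j\<close> on is A_(j+1), ..., A_n. Thus \<open>T 1\<close> is the full cut, and splitting
    A_i off \<open>T (i - 1)\<close> leaves \<open>T i\<close>.\<close>
  have P0: "P i \<ge> 0" if "2 \<le> i" "i \<le> n" for i
    unfolding P_def using that by (intro NA_pair_nonneg_and_polygamy(1)[OF state]) auto
  have T0: "T i \<ge> 0" if "1 \<le> i" "i < n" for i
    unfolding T_def using that by (intro NA_tail_nonneg[OF state]) auto
  have poly: "T (i - 1) \<le> P i + T i" if "2 \<le> i" "i < n" for i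
    using NA_pair_nonneg_and_polygamy(2)[OF state, of "i - 1"] that unfolding T_def P_def by simp
  \<comment> \<open>The last tail is A_n alone, so the chains end in \<open>P n\<close>.\<close>
  have last: "T (n - 1) = P n" if "3 \<le> n"
  proof -
    have "{n - 1..<n} = {n - 1}" using that by auto
    then show ?thesis unfolding T_def P_def by (simp add: insert_commute)
  qed
  note inc = increasing_chain[of n P T, OF P0 T0 poly k q s \<beta> l_def]
  note dec = decreasing_chain[of n P T, OF P0 T0 poly k q s \<beta> l_def]
  have l1: "l \<ge> 1" unfolding l_def using k q s \<beta> by (intro weight_ge_one) auto
  show ?thesis
  \<comment> \<open>The first case runs the increasing chain up to \<open>m\<close> and the
    decreasing one from \<open>m\<close> to n - 1; the \<open>l\<close> of the latter raises l^(m-1)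
    to l^m on all but the last term. The other two cases use a single chain from 1 to n - 1.\<close>
  proof (intro conjI allI impI)
    fix m assume H: "4 \<le> n \<and> 2 \<le> m \<and> m \<le> n - 2 \<and>
        (\<forall>i\<in>{2..m}. k * P i powr s \<le> T i powr s) \<and>
        (\<forall>j\<in>{m+1..n-1}. P j powr s \<ge> k * T j powr s)"
    let ?D = "\<Sum>j=m+1..n-1. q powr (real (j - m - 1) * \<beta> / s) * P j powr \<beta>"
    have I: "T 1 powr \<beta> \<le> q powr (\<beta> / s) * (\<Sum>i=2..m. l ^ (i - 2) * P i powr \<beta>) + l ^ (m - 1) * T m powr \<beta>"
      using H by (intro inc) auto
    have "T m powr \<beta> \<le> l * ?D + q powr (real (n - 1 - m) * \<beta> / s) * T (n - 1) powr \<beta>"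
      using H by (intro dec) auto
    also have "n - 1 - m = n - m - 1" by simp
    finally have "l ^ (m - 1) * T m powr \<beta> \<le> l ^ (m - 1) * (l * ?D + q powr (real (n - m - 1) * \<beta> / s) * P n powr \<beta>)"
      using l1 H last by (intro mult_left_mono) auto
    also have "\<dots> = (l * l ^ (m - 1)) * ?D + l ^ (m - 1) * q powr (real (n - m - 1) * \<beta> / s) * P n powr \<beta>"
      by (simp add: distrib_left mult_ac)
    also have "l * l ^ (m - 1) = l ^ m" using H by (cases m) auto
    finally show "T 1 powr \<beta> \<le>
        q powr (\<beta> / s) * (\<Sum>i=2..m. l ^ (i - 2) * P i powr \<beta>)
        + l ^ m * ?D + l ^ (m - 1) * q powr (real (n - m - 1) * \<beta> / s) * P n powr \<beta>"
      using I by linarith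
  next
    assume H: "3 \<le> n \<and> (\<forall>i\<in>{2..n-1}. k * P i powr s \<le> T i powr s)"
    have e: "n - 1 - 1 = n - 2" by simp
    have "T 1 powr \<beta> \<le> q powr (\<beta> / s) * (\<Sum>i=2..n-1. l ^ (i - 2) * P i powr \<beta>) + l ^ (n - 1 - 1) * T (n - 1) powr \<beta>"
      using H by (intro inc) auto
    then show "T 1 powr \<beta> \<le> q powr (\<beta> / s) * (\<Sum>i=2..n-1. l ^ (i - 2) * P i powr \<beta>) + l ^ (n - 2) * P n powr \<beta>"
      unfolding e using last H by simp
  next
    assume H: "3 \<le> n \<and> (\<forall>j\<in>{2..n-1}. P j powr s \<ge> k * T j powr s)"
    have e: "j - 1 - 1 = j - 2" for j :: nat by simp
    have "T 1 powr \<beta> \<le> l * (\<Sum>j=1+1..n-1. q powr (real (j - 1 - 1) * \<beta> / s) * P j powr \<beta>)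
       + q powr (real (n - 1 - 1) * \<beta> / s) * T (n - 1) powr \<beta>"
      using H by (intro dec) auto
    then show "T 1 powr \<beta> \<le> l * (\<Sum>j=2..n-1. q powr (real (j - 2) * \<beta> / s) * P j powr \<beta>)
        + q powr (real (n - 2) * \<beta> / s) * P n powr \<beta>"
      unfolding e one_add_one using last H by simp
  qed
qed

end
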